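(* There is an absolute constant $C$ such that the following holds. Let $N$ be a positive integer with $\sigma(N)=\alpha N$, where $\alpha=n/d$ with $n,d$ coprime positive integers, and write $N=\prod_{i=1}^{k}p_i^{e_i}$ with $p_1<\cdots<p_k$ distinct primes and $e_i\ge 1$. Then \[ N\leq d^C \prod_{i=1}^{k-1}p_i^{C(k-1)(p_k-1)/\log p_k}\; p_k^{C(k-1)(p_{k-1}-1)/\log p_{k-1}}. \] Furthermore, assume the following hypothesis (H): (i) the inequality $v_p(x^{p-1}-1)\leq 2+\frac{\log x+2\log\log x+\log\log p}{\log p}$ holds for all integers $x>1$ and primes $p$ except for finitely many pairs $(x,p)$; and (ii) the inequality $v_p(q^{p-1}-1)\leq 2+\frac{\log q+\log\log q+\log\log p}{\log p}$ holds for all pairs of primes $(q,p)$ except for finitely many pairs. Then there is an absolute constant $C'$ such that for every such $N$, \[ N<\max\left\{e^{k^2},\ d^{e/(e-2)}k^{-ke/(e-2)}\Big(\prod_{i=1}^k p_i\Big)^{kC'}\right\}. \]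
   Context: $\sigma(N)$ is the sum of the positive divisors of $N$; $v_p(n)$ is the exponent of the prime $p$ in the nonzero integer $n$; $\log$ is the natural logarithm and $e$ is Euler's number. *)

theory Defs
  imports Complex_Main "HOL-Computational_Algebra.Primes"
begin

definition divisor_sum :: "nat \<Rightarrow> nat" where
  "divisor_sum N = (\<Sum>a | a dvd N. a)"

text \<open>
  The sequences are indexed by \<open>{1..k}\<close>; values of \<open>p\<close> and \<open>e\<close> outside that range are
  unconstrained. The condition \<open>k \<ge> 1\<close> (that is, \<open>N > 1\<close>) is what makes the largest prime
  \<open>p k\<close> meaningful.
\<close>

definition abundancy_factorization ::
  "nat \<Rightarrow> nat \<Rightarrow> nat \<Rightarrow> nat \<Rightarrow> (nat \<Rightarrow> nat) \<Rightarrow> (nat \<Rightarrow> nat) \<Rightarrow> bool" where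
  "abundancy_factorization N n d k p e \<longleftrightarrow>
     N > 0 \<and> n > 0 \<and> d > 0 \<and> coprime n d \<and>
     real (divisor_sum N) = real n / real d * real N \<and>
     k \<ge> 1 \<and>
     (\<forall>i\<in>{1..k}. prime (p i) \<and> e i \<ge> 1) \<and>
     strict_mono_on {1..k} p \<and>
     N = (\<Prod>i=1..k. p i ^ e i)"

definition fermat_valuation_hypothesis :: bool where
  "fermat_valuation_hypothesis \<longleftrightarrow>
     finite {(x :: int, p :: nat). x > 1 \<and> prime p \<and>
       \<not> real (multiplicity (int p) (x ^ (p - 1) - 1))
           \<le> 2 + (ln (real_of_int x) + 2 * ln (ln (real_of_int x)) + ln (ln (real p))) / ln (real p)} \<and>
     finite {(q :: nat, p :: nat). prime q \<and> prime p \<and>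
       \<not> real (multiplicity (int p) (int q ^ (p - 1) - 1))
           \<le> 2 + (ln (real q) + ln (ln (real q)) + ln (ln (real p))) / ln (real p)}"

end

theory Submission
  imports Defs "HOL-Number_Theory.Number_Theory" "HOL-Computational_Algebra.Polynomial"
begin

text \<open>
  Comparing \<open>p\<^sub>i\<close>-adic valuations in \<open>d \<sigma>(N) = n N\<close> and lifting the exponent give
  \<open>e\<^sub>i \<le> v(d) + (\<Sum>j\<noteq>i. v(p\<^sub>j\<^bsup>p\<^sub>i - 1\<^esup> - 1) + v(e\<^sub>j + 1))\<close>, where \<open>v\<close> is the valuation at \<open>p\<^sub>i\<close>.
  Summed with weights \<open>ln p\<^sub>i\<close>, the last terms contribute at most \<open>\<Sum>j. ln (e\<^sub>j + 1)\<close>, which is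
  small against \<open>ln N\<close>. Both bounds then follow from an estimate of \<open>v\<^sub>p(q\<^bsup>p-1\<^esup> - 1)\<close>.

  Conditionally this estimate is part (ii) of the hypothesis. Unconditionally the trivial bound
  \<open>(p - 1) ln q / ln p\<close> has to be improved by a factor of order \<open>ln p\<close>. Let \<open>y\<close> be one of the primes
  2, 3. If \<open>q\<^bsup>p-1\<^esup> = 1\<close> modulo \<open>p\<^sup>T\<close>, then on the pairs \<open>(r, s)\<close> for which \<open>q\<^sup>r y\<^sup>s\<close> lies in a fixed
  class modulo \<open>p\<close>, the number \<open>q\<^sup>r y\<^sup>s\<close> modulo \<open>p\<^sup>T\<close> is \<open>\<xi> E\<^sup>s\<close> with \<open>E = 1\<close> modulo \<open>p\<close>. High
  finite differences in \<open>s\<close> of polynomials in \<open>s\<close> and \<open>E\<^sup>s\<close> are divisible by high powers of \<open>p\<close>,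
  so the pigeonhole principle produces a nonzero \<open>F(s, u)\<close> with small integer coefficients and
  \<open>p\<^sup>T\<close> dividing \<open>F(s, q\<^sup>r y\<^sup>s)\<close> at all these pairs. At small pairs this value is too small not
  to vanish, which gives \<open>F\<close> more zeros than it can have.
\<close>

section \<open>Finite differences, congruences and zeros of exponential polynomials\<close>

definition fdiff :: "(nat \<Rightarrow> int) \<Rightarrow> nat \<Rightarrow> int" where
  "fdiff f s = f (Suc s) - f s"

lemma funpow_fdiff_sum:
  "(fdiff ^^ D) (\<lambda>s. \<Sum>i\<in>I. c i * f i s) s = (\<Sum>i\<in>I. c i * (fdiff ^^ D) (f i) s)"
proof (induction D arbitrary: f)
  case (Suc D)
  have "fdiff (\<lambda>s. \<Sum>i\<in>I. c i * f i s) = (\<lambda>s. \<Sum>i\<in>I. c i * fdiff (f i) s)"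
    by (simp add: fun_eq_iff fdiff_def right_diff_distrib sum_subtractf)
  then show ?case
    using Suc.IH[of "\<lambda>i. fdiff (f i)"] by (simp add: funpow_swap1)
qed simp

lemma funpow_fdiff_lincomb2:
  "(fdiff ^^ D) (\<lambda>s. a * f s + b * g s) s = a * (fdiff ^^ D) f s + b * (fdiff ^^ D) g s"
  using funpow_fdiff_sum[of D "\<lambda>i::nat. if i = 0 then a else b" "\<lambda>i. if i = 0 then f else g" "{0,1}" s]
  by simp

text \<open>By Pascal's rule each difference splits into a part with a factor \<open>w - 1\<close>
  and a part where \<open>k\<close> drops by one. At most \<open>k\<close> of the \<open>D\<close>
  differences can be spent on lowering \<open>k\<close>, so \<open>D - k\<close> factors
  \<open>p\<close> remain.\<close>

lemma funpow_fdiff_choose_power_dvd: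
  fixes p w :: int
  assumes "p dvd w - 1"
  shows "p ^ (D - k) dvd (fdiff ^^ D) (\<lambda>s. int (s choose k) * w ^ s) s"
proof (induction D arbitrary: k s)
  case (Suc D)
  let ?f = "\<lambda>k s. int (s choose k) * w ^ s"
  have *: "(fdiff ^^ Suc D) (?f k) s = (fdiff ^^ D) (fdiff (?f k)) s"
    by (simp add: funpow_swap1)
  show ?case
  proof (cases k)
    case 0
    have "fdiff (?f k) = (\<lambda>s. (w - 1) * ?f 0 s + 0 * ?f 0 s)"
      by (simp add: fun_eq_iff fdiff_def 0 algebra_simps)
    then have "(fdiff ^^ Suc D) (?f k) s = (w - 1) * (fdiff ^^ D) (?f 0) s"
      unfolding * by (simp only: funpow_fdiff_lincomb2)
    then show ?thesis
      using Suc[of 0 s] assms 0 by (simp add: mult_dvd_mono)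
  next
    case (Suc j)
    have "fdiff (?f k) = (\<lambda>s. (w - 1) * ?f k s + w * ?f j s)"
      by (simp add: fun_eq_iff fdiff_def Suc algebra_simps)
    then have e: "(fdiff ^^ Suc D) (?f k) s
        = (w - 1) * (fdiff ^^ D) (?f k) s + w * (fdiff ^^ D) (?f j) s"
      unfolding * by (simp only: funpow_fdiff_lincomb2)
    have "p ^ Suc (D - k) dvd (w - 1) * (fdiff ^^ D) (?f k) s"
      using Suc.IH[of k s] assms by (simp add: mult_dvd_mono)
    then have "p ^ (Suc D - k) dvd (w - 1) * (fdiff ^^ D) (?f k) s"
      by (rule dvd_trans[OF le_imp_power_dvd, rotated]) simp
    moreover have "p ^ (Suc D - k) dvd w * (fdiff ^^ D) (?f j) s"
      using Suc.IH[of j s] Suc by simp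
    ultimately show ?thesis
      unfolding e by (rule dvd_add)
  qed
qed simp

text \<open>Newton interpolation modulo \<open>M\<close>: the first \<open>D\<close> values and the
  \<open>D\<close>-th differences determine everything. The induction passes to
  \<open>fdiff f\<close>, which needs one starting value fewer.\<close>

lemma dvd_of_funpow_fdiff_dvd:
  assumes "\<And>s. M dvd (fdiff ^^ D) f s" and "\<And>s. s < D \<Longrightarrow> M dvd f s"
  shows "M dvd f s"
  using assms
proof (induction D arbitrary: f s)
  case (Suc D)
  have step: "M dvd fdiff f t" for t
  proof (rule Suc.IH)
    show "M dvd (fdiff ^^ D) (fdiff f) s" for s
      using Suc.prems(1)[of s] by (simp add: funpow_swap1)
    show "M dvd fdiff f s" if "s < D" for s
      using Suc.prems(2)[of s] Suc.prems(2)[of "Suc s"] that by (simp add: fdiff_def)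
  qed
  show ?case
  proof (induction s)
    case 0
    then show ?case using Suc.prems(2)[of 0] by simp
  next
    case (Suc s)
    then show ?case using step[of s] unfolding fdiff_def by (metis dvd_add diff_add_cancel)
  qed
qed simp

text \<open>There are \<open>H ^ card I\<close> coefficient vectors with entries in
  \<open>{0..<H}\<close> but only \<open>M ^ D\<close> vectors of residues; two vectors with equal
  residues are subtracted.\<close>

lemma siegel_congruence:
  fixes a :: "'i \<Rightarrow> nat \<Rightarrow> int" and M H :: nat
  assumes "finite I" and "M > 0" and "M ^ D < H ^ card I"
  obtains c :: "'i \<Rightarrow> int"
  where "\<exists>i\<in>I. c i \<noteq> 0" and "\<And>i. i \<in> I \<Longrightarrow> \<bar>c i\<bar> \<le> int H"
    and "\<And>s. s < D \<Longrightarrow> int M dvd (\<Sum>i\<in>I. c i * a i s)"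
proof -
  define A where "A = (I \<rightarrow>\<^sub>E {0..<int H})"
  define B where "B = ({..<D} \<rightarrow>\<^sub>E {0..<int M})"
  define F where "F = (\<lambda>c. \<lambda>s\<in>{..<D}. (\<Sum>i\<in>I. c i * a i s) mod int M)"
  have "card B = M ^ D" "card A = H ^ card I"
    using assms(1) by (simp_all add: A_def B_def card_PiE)
  moreover have "F ` A \<subseteq> B"
    using assms(2) by (auto simp: F_def B_def split: if_splits)
  moreover have "finite B"
    unfolding B_def by (intro finite_PiE) auto
  ultimately have "card (F ` A) < card A"
    using assms(3) by (metis card_mono order_le_less_trans)
  then obtain c c' where c: "c \<in> A" "c' \<in> A" "c \<noteq> c'" "F c = F c'"
    by (meson inj_onI pigeonhole)
  show thesis
  proof (rule that[of "\<lambda>i. c i - c' i"])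
    show "\<exists>i\<in>I. c i - c' i \<noteq> 0"
    proof (rule ccontr)
      assume "\<not> ?thesis"
      then have "c = c'"
        using c(1,2) unfolding A_def by (intro PiE_ext[of c I _ c']) auto
      then show False using c(3) by simp
    qed
    show "\<bar>c i - c' i\<bar> \<le> int H" if "i \<in> I" for i
    proof -
      have "c i \<in> {0..<int H}" "c' i \<in> {0..<int H}"
        using c(1,2) that unfolding A_def by (auto simp: PiE_iff)
      then show ?thesis by auto
    qed
    show "int M dvd (\<Sum>i\<in>I. (c i - c' i) * a i s)" if "s < D" for s
    proof -
      have "(\<Sum>i\<in>I. c i * a i s) mod int M = (\<Sum>i\<in>I. c' i * a i s) mod int M"
        using fun_cong[OF c(4), of s] that by (simp add: F_def)
      then show ?thesis
        by (simp add: left_diff_distrib sum_subtractf mod_eq_dvd_iff)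
    qed
  qed
qed

text \<open>
  The combination \<open>A\<^sub>t(x) F(x + \<sigma>, \<omega> v) - \<omega>\<^sup>t A\<^sub>t(x + \<sigma>) F(x, v)\<close> of two translates loses the term of
  index \<open>t\<close> and no other one, at the price of doubling the degree.
\<close>

lemma card_zeros_exp_poly_le:
  fixes A :: "nat \<Rightarrow> real poly" and \<sigma> \<omega> :: real
  assumes "finite \<Lambda>" and "card \<Lambda> = Suc n" and "\<omega> > 0" and "\<omega> \<noteq> 1"
    and "\<And>l. l \<in> \<Lambda> \<Longrightarrow> A l \<noteq> 0 \<and> degree (A l) \<le> \<delta>"
    and "\<And>s u i. (s, u) \<in> E \<Longrightarrow> i \<le> n \<Longrightarrow>
           u > 0 \<and> (\<Sum>l\<in>\<Lambda>. poly (A l) (s + real i * \<sigma>) * (u * \<omega> ^ i) ^ l) = 0"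
  shows "finite (fst ` E) \<and> card (fst ` E) \<le> 2 ^ n * \<delta>"
  using assms(1,2,5,6)
proof (induction n arbitrary: \<Lambda> A \<delta>)
  case 0
  then obtain l where l: "\<Lambda> = {l}"
    by (auto simp: card_Suc_eq)
  have "fst ` E \<subseteq> {x. poly (A l) x = 0}"
  proof clarsimp
    fix s u assume "(s, u) \<in> E"
    then show "poly (A l) s = 0"
      using "0.prems"(4)[of s u 0] l by auto
  qed
  moreover have "A l \<noteq> 0" "degree (A l) \<le> \<delta>"
    using "0.prems"(3) l by auto
  ultimately show ?case
    using card_poly_roots_bound[of "A l"] poly_roots_finite[of "A l"]
    by (metis (no_types, lifting) card_mono finite_subset le_trans mult_1 power_0)
next
  case (Suc n)
  then obtain t where t: "t \<in> \<Lambda>"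
    by fastforce
  define sh where "sh = (\<lambda>P :: real poly. pcompose P [:\<sigma>, 1:])"
  define B where "B = (\<lambda>l. smult (\<omega> ^ l) (A t * sh (A l)) - smult (\<omega> ^ t) (sh (A t) * A l))"
  have poly_sh: "poly (sh P) x = poly P (x + \<sigma>)" for P x
    by (simp add: sh_def poly_pcompose add.commute)
  have deg_sh: "degree (sh P) = degree P" for P
    by (simp add: sh_def degree_pcompose)
  have lead_sh: "lead_coeff (sh P) = lead_coeff P" for P
    by (simp add: sh_def lead_coeff_comp)
  have "finite (fst ` E) \<and> card (fst ` E) \<le> 2 ^ n * (2 * \<delta>)"
  proof (rule Suc.IH)
    show "finite (\<Lambda> - {t})" "card (\<Lambda> - {t}) = Suc n"
      using Suc.prems t by auto
  next
    fix l assume l: "l \<in> \<Lambda> - {t}"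
    have A: "A l \<noteq> 0" "degree (A l) \<le> \<delta>" "A t \<noteq> 0" "degree (A t) \<le> \<delta>"
      using Suc.prems(3)[of l] Suc.prems(3)[of t] l t by auto
    \<comment> \<open>A shift preserves degree and leading coefficient, so the two top terms of
      \<open>B l\<close> differ only in the factors \<open>\<omega> ^ l\<close> and
      \<open>\<omega> ^ t\<close>, which are distinct.\<close>
    have "coeff (B l) (degree (A t) + degree (A l))
        = (\<omega> ^ l - \<omega> ^ t) * (lead_coeff (A t) * lead_coeff (A l))"
      using coeff_mult_degree_sum[of "A t" "sh (A l)"] coeff_mult_degree_sum[of "sh (A t)" "A l"]
      by (simp add: B_def lead_sh[unfolded deg_sh] deg_sh algebra_simps)
    moreover have "\<omega> ^ l \<noteq> \<omega> ^ t"
    proof -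
      have "\<omega> ^ a \<noteq> \<omega> ^ b" if "a < b" for a b
        using assms(3,4) that power_strict_increasing[of a b \<omega>] power_strict_decreasing[of a b \<omega>]
        by (cases "\<omega> < 1") force+
      then show ?thesis
        using l by (metis DiffD2 insertI1 nat_neq_iff)
    qed
    ultimately have "B l \<noteq> 0"
      using A by auto
    moreover have "degree (B l) \<le> 2 * \<delta>"
    proof -
      have "degree (A t * sh (A l)) \<le> 2 * \<delta>" "degree (sh (A t) * A l) \<le> 2 * \<delta>"
        using degree_mult_le[of "A t" "sh (A l)"] degree_mult_le[of "sh (A t)" "A l"] A
        by (auto simp: deg_sh)
      then show ?thesis
        unfolding B_def by (meson degree_diff_le degree_smult_le le_trans)
    qed
    ultimately show "B l \<noteq> 0 \<and> degree (B l) \<le> 2 * \<delta>" by simp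
  next
    fix s u i assume su: "(s, u) \<in> E" and i: "i \<le> n"
    \<comment> \<open>Vanishing of the new family at step \<open>i\<close> uses the old one at steps
      \<open>i\<close> and \<open>i + 1\<close>, so each eliminated index consumes one
      translate.\<close>
    define x v where "x = s + real i * \<sigma>" and "v = u * \<omega> ^ i"
    have z0: "(\<Sum>l\<in>\<Lambda>. poly (A l) x * v ^ l) = 0" and "u > 0"
      using Suc.prems(4)[OF su, of i] i by (auto simp: x_def v_def)
    have z1: "(\<Sum>l\<in>\<Lambda>. poly (A l) (x + \<sigma>) * (\<omega> * v) ^ l) = 0"
      using Suc.prems(4)[OF su, of "Suc i"] i by (simp add: x_def v_def algebra_simps)
    have "(\<Sum>l\<in>\<Lambda> - {t}. poly (B l) x * v ^ l) = (\<Sum>l\<in>\<Lambda>. poly (B l) x * v ^ l)"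
    proof -
      have "B t = 0" by (simp add: B_def mult.commute)
      then show ?thesis
        using Suc.prems(1) t by (simp add: sum.remove[of \<Lambda> t])
    qed
    also have "\<dots> = poly (A t) x * (\<Sum>l\<in>\<Lambda>. poly (A l) (x + \<sigma>) * (\<omega> * v) ^ l)
        - \<omega> ^ t * poly (A t) (x + \<sigma>) * (\<Sum>l\<in>\<Lambda>. poly (A l) x * v ^ l)"
      by (simp add: sum_distrib_left B_def poly_sh algebra_simps power_mult_distrib sum_subtractf)
    finally show "u > 0 \<and> (\<Sum>l\<in>\<Lambda> - {t}. poly (B l) (s + real i * \<sigma>) * (u * \<omega> ^ i) ^ l) = 0"
      using z0 z1 \<open>u > 0\<close> by (simp add: x_def v_def)
  qed
  then show ?case by (simp add: mult_ac)
qed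

section \<open>The auxiliary function\<close>

text \<open>In \<open>x ^ p - y ^ p\<close> the cofactor of \<open>x - y\<close> is a sum of
  \<open>p\<close> terms that are all congruent modulo \<open>p\<close>, hence divisible by
  \<open>p\<close>; so each \<open>p\<close>-th power gains one factor.\<close>

lemma cong_power_lift:
  fixes a b :: int and p :: nat
  assumes "[a = b] (mod int p)"
  shows "[a ^ (p ^ n) = b ^ (p ^ n)] (mod int p ^ Suc n)"
proof (induction n)
  case 0
  then show ?case using assms by simp
next
  case (Suc n)
  define x y where "x = a ^ (p ^ n)" and "y = b ^ (p ^ n)"
  have xy: "[x = y] (mod int p ^ Suc n)"
    using Suc by (simp add: x_def y_def)
  then have xyp: "[x = y] (mod int p)"
    by (rule cong_dvd_modulus) simp
  have "[(\<Sum>i<p. y ^ (p - Suc i) * x ^ i) = (\<Sum>i<p. x ^ (p - Suc i) * x ^ i)] (mod int p)"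
    by (intro cong_sum cong_mult cong_pow cong_refl cong_sym[OF xyp])
  also have "(\<Sum>i<p. x ^ (p - Suc i) * x ^ i) = int p * x ^ (p - 1)"
    by (simp flip: power_add)
  also have "[\<dots> = 0] (mod int p)"
    by (simp add: cong_0_iff)
  finally have "int p dvd (\<Sum>i<p. y ^ (p - Suc i) * x ^ i)"
    by (simp add: cong_0_iff)
  moreover have "int p ^ Suc n dvd x - y"
    using xy by (simp add: cong_iff_dvd_diff)
  ultimately have "int p ^ Suc n * int p dvd x ^ p - y ^ p"
    by (subst power_diff_sumr2) (rule mult_dvd_mono)
  then have "[x ^ p = y ^ p] (mod int p ^ Suc (Suc n))"
    by (simp add: cong_iff_dvd_diff mult_ac)
  then show ?case
    by (simp add: x_def y_def mult.commute flip: power_mult)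
qed

text \<open>
  With \<open>P = p\<^bsup>8K - 1\<^esup>\<close>, the power \<open>u\<^sup>P\<close> modulo \<open>p\<^bsup>8K\<^esup>\<close> depends only on \<open>u\<close> modulo \<open>p\<close> (it is the
  Teichmueller representative of \<open>u\<close>), and the exponent of \<open>y\<close> in \<open>E\<close> is chosen so that
  \<open>u = E\<^sup>s u\<^sup>P\<close> modulo \<open>p\<^bsup>8K\<^esup>\<close> for \<open>u = q\<^sup>r y\<^sup>s\<close>. Binomial coefficients serve as the polynomials in \<open>s\<close>
  because they are at most \<open>2\<^sup>s\<close>.
\<close>

lemma auxiliary_function:
  fixes p q y K L :: nat and \<xi> :: int
  assumes p: "prime p" and y: "coprime y p" and K: "K > 0" and L: "L > 18"
    and q: "[int q ^ (p - 1) = 1] (mod int p ^ (8 * K))"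
  obtains c :: "nat \<times> nat \<Rightarrow> int"
  where "\<exists>i\<in>{..<K} \<times> {..<L}. c i \<noteq> 0"
    and "\<And>i. i \<in> {..<K} \<times> {..<L} \<Longrightarrow> \<bar>c i\<bar> \<le> int (p ^ (4 * K))"
    and "\<And>r s. [int (q ^ r * y ^ s) = \<xi>] (mod int p) \<Longrightarrow>
           int p ^ (8 * K) dvd
             (\<Sum>i\<in>{..<K} \<times> {..<L}. c i * (int (s choose fst i) * int (q ^ r * y ^ s) ^ snd i))"
proof -
  define T where "T = 8 * K"
  define P where "P = p ^ (T - 1)"
  define E where "E = int y ^ (1 + (p - 2) * P)"
  define I where "I = {..<K} \<times> {..<L}"
  define a where "a = (\<lambda>i s. int (s choose fst i) * (\<xi> ^ P * E ^ s) ^ snd i)"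
  have T: "T = Suc (T - 1)" using K by (simp add: T_def)
  have p2: "p \<ge> 2" using p by (rule prime_ge_2_nat)
  obtain m where m: "p = m + 2"
    using p2 by (metis add.commute le_Suc_ex)
  \<comment> \<open>Since \<open>P\<close> is 1 modulo \<open>p - 1\<close>, \<open>q ^ P\<close> is
    congruent to \<open>q\<close> modulo \<open>p ^ T\<close>, and the exponent of \<open>y\<close>
    in \<open>E\<close> is a multiple of \<open>p - 1\<close>.\<close>
  have "\<exists>z. p ^ n = 1 + (p - 1) * z" for n
  proof (induction n)
    case (Suc n)
    then obtain z where "p ^ n = 1 + (p - 1) * z" by blast
    then have "p ^ Suc n = 1 + (p - 1) * (1 + p * z)"
      by (simp add: m algebra_simps)
    then show ?case by blast
  qed simp
  then obtain z where z: "P = 1 + (p - 1) * z"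
    unfolding P_def by blast
  have yp: "[int y ^ (p - 1) = 1] (mod int p)"
  proof -
    have "\<not> p dvd y"
      using y p by (metis coprime_absorb_right not_prime_unit)
    then show ?thesis
      using fermat_theorem[OF p, of y] by (simp flip: cong_int_iff)
  qed
  have E1: "int p dvd E - 1"
  proof -
    have "1 + (p - 2) * P = (p - 1) * (1 + (p - 2) * z)"
      by (simp add: z m algebra_simps)
    then have "E = (int y ^ (p - 1)) ^ (1 + (p - 2) * z)"
      by (simp only: E_def power_mult)
    also have "[\<dots> = 1 ^ (1 + (p - 2) * z)] (mod int p)"
      using yp by (rule cong_pow)
    finally show ?thesis by (simp add: cong_iff_dvd_diff)
  qed
  have rep: "[int (q ^ r * y ^ s) = \<xi> ^ P * E ^ s] (mod int p ^ T)"
    if "[int (q ^ r * y ^ s) = \<xi>] (mod int p)" for r s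
  proof -
    define u where "u = int (q ^ r * y ^ s)"
    have "[u ^ P = \<xi> ^ P] (mod int p ^ T)"
      using cong_power_lift[OF that, of "T - 1"] T by (simp add: u_def P_def)
    then have 1: "[u ^ P * E ^ s = \<xi> ^ P * E ^ s] (mod int p ^ T)"
      by (intro cong_mult cong_refl)
    have qP: "[int q ^ P = int q] (mod int p ^ T)"
    proof -
      have "int q ^ P = int q * (int q ^ (p - 1)) ^ z"
        by (simp add: z power_add power_mult)
      also have "[\<dots> = int q * 1 ^ z] (mod int p ^ T)"
        using q by (intro cong_mult cong_pow cong_refl) (simp add: T_def)
      finally show ?thesis by simp
    qed
    have yP: "[(int y ^ (p - 1)) ^ P = 1] (mod int p ^ T)"
      using cong_power_lift[OF yp, of "T - 1"] T by (simp add: P_def)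
    have e: "1 + (p - 2) * P + P = 1 + (p - 1) * P"
      by (simp add: m algebra_simps)
    have "u ^ P * E ^ s = (int q ^ P) ^ r * (int y ^ (1 + (p - 2) * P + P)) ^ s"
      unfolding u_def E_def power_add
      by (simp add: power_mult_distrib mult_ac flip: power_mult)
    also have "\<dots> = (int q ^ P) ^ r * (int y * (int y ^ (p - 1)) ^ P) ^ s"
      unfolding e by (simp add: power_add power_mult)
    also have "[\<dots> = int q ^ r * (int y * 1) ^ s] (mod int p ^ T)"
      by (intro cong_mult cong_pow cong_refl qP yP)
    finally have "[u ^ P * E ^ s = u] (mod int p ^ T)"
      by (simp add: u_def)
    with 1 show ?thesis
      unfolding u_def by (metis cong_sym cong_trans)
  qed
  \<comment> \<open>For \<open>9 * K\<close> conditions modulo \<open>p ^ (8 * K)\<close> and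
    \<open>K * L\<close> unknowns of size \<open>p ^ (4 * K)\<close>, the exponents to compare are
    \<open>72 * K * K\<close> and \<open>4 * L * K * K\<close>; hence \<open>L > 18\<close>.\<close>
  have "(p ^ T) ^ (9 * K) < (p ^ (4 * K)) ^ card I"
  proof -
    have "T * (9 * K) = 72 * (K * K)" "4 * K * card I = (4 * L) * (K * K)"
      by (simp_all add: T_def I_def)
    moreover have "72 * (K * K) < (4 * L) * (K * K)"
      using L K by simp
    ultimately show ?thesis
      using p2 unfolding power_mult[symmetric] by (intro power_strict_increasing) simp_all
  qed
  then obtain c where c: "\<exists>i\<in>I. c i \<noteq> 0" "\<And>i. i \<in> I \<Longrightarrow> \<bar>c i\<bar> \<le> int (p ^ (4 * K))"
    "\<And>s. s < 9 * K \<Longrightarrow> int (p ^ T) dvd (\<Sum>i\<in>I. c i * a i s)"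
    using siegel_congruence[of I "p ^ T" "9 * K" "p ^ (4 * K)" a] p2 unfolding I_def by auto
  \<comment> \<open>Differences of order \<open>9 * K\<close> carry at least
    \<open>9 * K - k\<close> factors \<open>p\<close> with \<open>k < K\<close>, which covers
    \<open>T = 8 * K\<close>. So the conditions imposed for \<open>s < 9 * K\<close> extend to every
    \<open>s\<close>.\<close>
  have all: "int p ^ T dvd (\<Sum>i\<in>I. c i * a i s)" for s
  proof (rule dvd_of_funpow_fdiff_dvd[of _ "9 * K"])
    show "int p ^ T dvd (\<Sum>i\<in>I. c i * a i s)" if "s < 9 * K" for s
      using c(3)[OF that] by simp
    show "int p ^ T dvd (fdiff ^^ (9 * K)) (\<lambda>s. \<Sum>i\<in>I. c i * a i s) s" for s
    proof -
      have "a i s = (\<xi> ^ P) ^ snd i * (int (s choose fst i) * (E ^ snd i) ^ s)" for i s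
        by (simp add: a_def power_mult_distrib mult_ac flip: power_mult)
      then have "(\<lambda>s. \<Sum>i\<in>I. c i * a i s)
          = (\<lambda>s. \<Sum>i\<in>I. (c i * (\<xi> ^ P) ^ snd i) * (int (s choose fst i) * (E ^ snd i) ^ s))"
        by (simp add: mult.assoc)
      moreover have "int p ^ T dvd (fdiff ^^ (9 * K)) (\<lambda>s. int (s choose fst i) * (E ^ snd i) ^ s) s"
        if "i \<in> I" for i
      proof -
        have "int p dvd E ^ snd i - 1"
          using E1 by (metis dvd_trans dvd_triv_left power_diff_1_eq)
        then have "int p ^ (9 * K - fst i) dvd (fdiff ^^ (9 * K)) (\<lambda>s. int (s choose fst i) * (E ^ snd i) ^ s) s"
          by (rule funpow_fdiff_choose_power_dvd)
        moreover have "T \<le> 9 * K - fst i"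
          using that by (auto simp: T_def I_def)
        ultimately show ?thesis
          by (meson dvd_trans le_imp_power_dvd)
      qed
      ultimately show ?thesis
        by (simp only: funpow_fdiff_sum) (intro dvd_sum dvd_mult, simp)
    qed
  qed
  show thesis
  proof (rule that[of c, folded I_def])
    fix r s assume "[int (q ^ r * y ^ s) = \<xi>] (mod int p)"
    then have "[(\<Sum>i\<in>I. c i * (int (s choose fst i) * int (q ^ r * y ^ s) ^ snd i))
        = (\<Sum>i\<in>I. c i * a i s)] (mod int p ^ T)"
      unfolding a_def by (intro cong_sum cong_mult cong_pow cong_refl rep)
    then show "int p ^ (8 * K) dvd (\<Sum>i\<in>I. c i * (int (s choose fst i) * int (q ^ r * y ^ s) ^ snd i))"
      using all[of s] by (simp add: T_def cong_dvd_iff)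
  qed (use c in auto)
qed

section \<open>Extrapolation and contradiction\<close>

lemma pigeonhole_fibre:
  assumes "finite A" and "finite B" and "f ` A \<subseteq> B" and "card B * m < card A"
  obtains b where "b \<in> B" and "m < card {x \<in> A. f x = b}"
proof -
  have "\<exists>b\<in>B. m < card {x \<in> A. f x = b}"
  proof (rule ccontr)
    assume "\<not> ?thesis"
    then have le: "card {x \<in> A. f x = b} \<le> m" if "b \<in> B" for b
      using that by (meson not_le)
    have "A = (\<Union>b\<in>B. {x \<in> A. f x = b})"
      using assms(3) by auto
    then have "card A \<le> (\<Sum>b\<in>B. card {x \<in> A. f x = b})"
      using card_UN_le[OF assms(2), of "\<lambda>b. {x \<in> A. f x = b}"] by simp
    also have "\<dots> \<le> card B * m"
      using sum_bounded_above[of B "\<lambda>b. card {x \<in> A. f x = b}" m] le by simp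
    finally show False using assms(4) by simp
  qed
  then show thesis using that by blast
qed

section \<open>Binomial coefficients as real polynomials\<close>

definition binom_poly :: "nat \<Rightarrow> real poly" where
  "binom_poly k = smult (1 / fact k) (\<Prod>i<k. [:- real i, 1:])"

lemma poly_binom_poly: "poly (binom_poly k) (real s) = real (s choose k)"
  by (simp add: binom_poly_def poly_prod binomial_gbinomial gbinomial_prod_rev lessThan_atLeast0)

lemma degree_binom_poly_le: "degree (binom_poly k) \<le> k"
proof -
  have "degree (\<Prod>i<k. [:- real i, 1:]) \<le> (\<Sum>i<k. degree [:- real i, 1:])"
    using degree_prod_sum_le[of "{..<k}" "\<lambda>i. [:- real i, 1:]"] by (simp add: o_def)
  then show ?thesis
    unfolding binom_poly_def using degree_smult_le[of "1 / fact k" "\<Prod>i<k. [:- real i, 1:]"]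
    by simp
qed

text \<open>Evaluation at the least \<open>j\<close> with \<open>c j \<noteq> 0\<close> isolates
  \<open>c j\<close>: lower coefficients vanish, and \<open>j choose i = 0\<close> for higher
  \<open>i\<close>.\<close>

lemma sum_binom_poly_nonzero:
  fixes c :: "nat \<Rightarrow> real"
  assumes "k < K" and "c k \<noteq> 0"
  shows "(\<Sum>k<K. smult (c k) (binom_poly k)) \<noteq> 0"
proof
  assume z: "(\<Sum>k<K. smult (c k) (binom_poly k)) = 0"
  define j where "j = (LEAST k. c k \<noteq> 0)"
  have j: "c j \<noteq> 0" "j \<le> k" and least: "\<And>i. i < j \<Longrightarrow> c i = 0"
    unfolding j_def using assms(2) LeastI[of "\<lambda>k. c k \<noteq> 0" k]
    by (auto intro: Least_le dest: not_less_Least)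
  have "0 = poly (\<Sum>k<K. smult (c k) (binom_poly k)) (real j)"
    by (simp add: z)
  also have "\<dots> = (\<Sum>i<K. c i * real (j choose i))"
    by (simp add: poly_sum poly_binom_poly)
  also have "\<dots> = (\<Sum>i\<in>{j}. c i * real (j choose i))"
  proof (rule sum.mono_neutral_right)
    show "\<forall>i\<in>{..<K} - {j}. c i * real (j choose i) = 0"
      using least by (auto simp: binomial_eq_0_iff neq_iff)
  qed (use j assms in auto)
  finally show False using j by simp
qed

lemma prime_powers_mult_eq_iff:
  fixes q y :: nat
  assumes q: "prime q" and y: "prime y" and "q \<noteq> y"
  shows "q ^ r * y ^ s = q ^ r' * y ^ s' \<longleftrightarrow> r = r' \<and> s = s'"
proof
  assume eq: "q ^ r * y ^ s = q ^ r' * y ^ s'"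
  have m: "multiplicity q (q ^ r * y ^ s) = r" "multiplicity y (q ^ r * y ^ s) = s" for r s
    using assms by (simp_all add: prime_elem_multiplicity_mult_distrib prime_elem_multiplicity_power_distrib
        prime_gt_0_nat prime_multiplicity_other)
  show "r = r' \<and> s = s'"
    using m(1)[of r s] m(1)[of r' s'] m(2)[of r s] m(2)[of r' s'] eq by simp
qed simp

text \<open>\<open>cnt\<close> puts more than \<open>2 ^ L * K\<close> pairs of the large box into
  one class modulo \<open>p\<close>; \<open>cnt'\<close> gives two distinct pairs of the small box
  in a common class, whose difference is a translation preserving classes. By \<open>size\<close>
  the auxiliary function vanishes along these translates. The zero estimate then limits the number
  of values of \<open>s\<close>, while \<open>ord\<close> keeps them distinct.\<close>

lemma interpolation_contradiction:
  fixes p q y K L R S :: nat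
  assumes p: "prime p" and q: "prime q" and y: "prime y"
    and ne: "q \<noteq> p" "y \<noteq> p" "q \<noteq> y" and K: "K > 0" and L: "L > 18"
    and qT: "[int q ^ (p - 1) = 1] (mod int p ^ (8 * K))"
    and ord: "\<And>j. 0 < j \<Longrightarrow> j < L * R \<Longrightarrow> \<not> [q ^ j = 1] (mod p)"
    and cnt: "p * (2 ^ L * K) < (L * R) * (L * S)" and cnt': "p < R * S"
    and size: "K * L * 2 ^ (2 * L * S) * (q ^ (2 * L * R) * y ^ (2 * L * S)) ^ L < p ^ (4 * K)"
  shows False
proof -
  have cop: "coprime q p" "coprime y p"
    using p q y ne by (auto intro: primes_coprime)
  define v where "v = (\<lambda>(r, s). q ^ r * y ^ s)"
  have v_pos: "v x > 0" for x
    using q y by (auto simp: v_def prime_gt_0_nat split: prod.splits)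
  have cop_v: "coprime (v x) p" for x
    using cop by (auto simp: v_def split: prod.splits)
  have range: "(\<lambda>x. v x mod p) ` A \<subseteq> {..<p}" for A
    using p by (auto simp: prime_gt_0_nat)
  define Box where "Box = {..<L * R} \<times> {..<L * S}"
  have "card {..<p} * (2 ^ L * K) < card Box"
    using cnt by (simp add: Box_def)
  then obtain b where b: "2 ^ L * K < card {x \<in> Box. v x mod p = b}"
    by (rule pigeonhole_fibre[OF _ _ range[of Box], rotated 2]) (auto simp: Box_def)
  define Cl where "Cl = {x \<in> Box. v x mod p = b}"
  have "\<not> inj_on (\<lambda>x. v x mod p) ({..<R} \<times> {..<S})"
  proof (rule pigeonhole)
    have "card ((\<lambda>x. v x mod p) ` ({..<R} \<times> {..<S})) \<le> card {..<p}"
      by (rule card_mono[OF _ range]) simp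
    then show "card ((\<lambda>x. v x mod p) ` ({..<R} \<times> {..<S})) < card ({..<R} \<times> {..<S})"
      using cnt' by simp
  qed
  then obtain r1 s1 r2 s2 where rs: "r1 < R" "s1 < S" "r2 < R" "s2 < S" "(r1, s1) \<noteq> (r2, s2)"
    and v12: "[v (r1, s1) = v (r2, s2)] (mod p)"
    by (auto simp: inj_on_def cong_def)
  have v_ne: "v (r1, s1) \<noteq> v (r2, s2)"
    using rs(5) prime_powers_mult_eq_iff[OF q y ne(3)] by (auto simp: v_def)
  define I where "I = {..<K} \<times> {..<L}"
  \<comment> \<open>Adding \<open>i\<close> copies of \<open>(r1, s1)\<close> and
    \<open>L - 1 - i\<close> copies of \<open>(r2, s2)\<close> to a pair of class \<open>b\<close>
    always lands in this class. Moving along the difference of the two pairs thus never needs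
    negative exponents.\<close>
  define \<xi> where "\<xi> = int (b * v (r2, s2) ^ (L - 1))"
  define F where "F = (\<lambda>c s u. \<Sum>i\<in>I. c i * (int (s choose fst i) * int u ^ snd i))"
  obtain c where c_ex: "\<exists>i\<in>I. c i \<noteq> 0"
    and c_le: "\<And>i. i \<in> I \<Longrightarrow> \<bar>c i\<bar> \<le> int (p ^ (4 * K))"
    and c_dvd: "\<And>r s. [int (v (r, s)) = \<xi>] (mod int p) \<Longrightarrow> int p ^ (8 * K) dvd F c s (v (r, s))"
    using auxiliary_function[OF p cop(2) K L qT, of \<xi>] unfolding I_def F_def v_def case_prod_conv
    by blast
  \<comment> \<open>By \<open>size\<close> the sum of all \<open>K * L\<close> terms is below
    \<open>p ^ (8 * K)\<close> in absolute value, so divisibility forces it to be zero.\<close>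
  have zero: "F c s (v (r, s)) = 0"
    if "[int (v (r, s)) = \<xi>] (mod int p)" "r \<le> 2 * L * R" and s_le: "s \<le> 2 * L * S" for r s
  proof -
    define W where "W = q ^ (2 * L * R) * y ^ (2 * L * S)"
    have W: "v (r, s) \<le> W" "W \<ge> 1"
      using that(2,3) q y by (auto simp: v_def W_def prime_gt_0_nat intro!: mult_le_mono power_increasing Suc_leI)
    have "\<bar>c i * (int (s choose fst i) * int (v (r, s)) ^ snd i)\<bar>
        \<le> int (p ^ (4 * K) * (2 ^ (2 * L * S) * W ^ L))" if i: "i \<in> I" for i
    proof -
      have "s choose fst i \<le> 2 ^ (2 * L * S)"
        by (rule order_trans[OF binomial_le_pow2 power_increasing[OF s_le]]) simp
      moreover have "v (r, s) ^ snd i \<le> W ^ L"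
      proof -
        have "v (r, s) ^ snd i \<le> W ^ snd i" using W by (intro power_mono) auto
        also have "\<dots> \<le> W ^ L" using W i by (intro power_increasing) (auto simp: I_def)
        finally show ?thesis .
      qed
      ultimately have "int (s choose fst i) * int (v (r, s)) ^ snd i \<le> int (2 ^ (2 * L * S) * W ^ L)"
        by (metis mult_le_mono of_nat_le_iff of_nat_mult of_nat_power)
      then have "\<bar>c i\<bar> * (int (s choose fst i) * int (v (r, s)) ^ snd i)
          \<le> int (p ^ (4 * K)) * int (2 ^ (2 * L * S) * W ^ L)"
        using c_le[OF i] by (intro mult_mono) auto
      then show ?thesis
        by (simp add: abs_mult)
    qed
    then have "\<bar>F c s (v (r, s))\<bar> \<le> int (card I) * int (p ^ (4 * K) * (2 ^ (2 * L * S) * W ^ L))"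
      unfolding F_def by (intro order_trans[OF sum_abs] sum_bounded_above) auto
    also have "\<dots> = int (p ^ (4 * K)) * int (K * L * 2 ^ (2 * L * S) * W ^ L)"
      by (simp add: I_def mult_ac)
    also have "\<dots> < int (p ^ (4 * K)) * int (p ^ (4 * K))"
      using size p unfolding W_def[symmetric] by (intro mult_strict_left_mono) (simp_all only: of_nat_less_iff of_nat_0_less_iff zero_less_power prime_gt_0_nat)
    also have "\<dots> = int p ^ (8 * K)"
      by (simp flip: power_add)
    finally show ?thesis
      using c_dvd[OF that(1)] by (metis abs_dvd_iff dvd_abs_iff dvd_imp_le_int not_le abs_of_nat of_nat_power)
  qed
  \<comment> \<open>\<open>A l\<close> is the coefficient of \<open>u ^ l\<close> in
    \<open>F\<close>, as a real polynomial in \<open>s\<close>; the zero estimate requires the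
    vanishing ones to be discarded.\<close>
  define A where "A = (\<lambda>l. \<Sum>k<K. smult (real_of_int (c (k, l))) (binom_poly k))"
  define \<Lambda> where "\<Lambda> = {l \<in> {..<L}. A l \<noteq> 0}"
  have A_sum: "(\<Sum>l\<in>\<Lambda>. poly (A l) (real s) * real u ^ l) = real_of_int (F c s u)" for s u
  proof -
    have "(\<Sum>l\<in>\<Lambda>. poly (A l) (real s) * real u ^ l) = (\<Sum>l<L. poly (A l) (real s) * real u ^ l)"
      by (rule sum.mono_neutral_left) (auto simp: \<Lambda>_def)
    also have "\<dots> = (\<Sum>l<L. \<Sum>k<K. real_of_int (c (k, l)) * (real (s choose k) * real u ^ l))"
      by (simp add: A_def poly_sum poly_binom_poly sum_distrib_right mult.assoc)
    also have "\<dots> = (\<Sum>k<K. \<Sum>l<L. real_of_int (c (k, l)) * (real (s choose k) * real u ^ l))"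
      by (rule sum.swap)
    also have "\<dots> = real_of_int (F c s u)"
      by (simp add: F_def I_def sum.cartesian_product case_prod_unfold)
    finally show ?thesis .
  qed
  have "\<Lambda> \<noteq> {}"
  proof -
    obtain k l where "k < K" "l < L" "c (k, l) \<noteq> 0"
      using c_ex by (auto simp: I_def)
    then have "A l \<noteq> 0"
      unfolding A_def using sum_binom_poly_nonzero[of k K "\<lambda>k. real_of_int (c (k, l))"] by simp
    then show ?thesis using \<open>l < L\<close> by (auto simp: \<Lambda>_def)
  qed
  moreover have fin: "finite \<Lambda>" and "card \<Lambda> \<le> L"
    using card_mono[of "{..<L}" \<Lambda>] by (auto simp: \<Lambda>_def)
  ultimately obtain n where n: "card \<Lambda> = Suc n" "n < L"
    by (metis Suc_le_lessD card_gt_0_iff gr0_implies_Suc)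
  define E where "E = (\<lambda>(r, s). (real (s + (L - 1) * s2), real (v (r, s) * v (r2, s2) ^ (L - 1)))) ` Cl"
  have "finite (fst ` E) \<and> card (fst ` E) \<le> 2 ^ n * K"
  proof (rule card_zeros_exp_poly_le[where A = A and \<sigma> = "real s1 - real s2" and \<omega> = "real (v (r1, s1)) / real (v (r2, s2))"])
    show "finite \<Lambda>" "card \<Lambda> = Suc n" by (fact fin) (fact n)
    show "real (v (r1, s1)) / real (v (r2, s2)) > 0" "real (v (r1, s1)) / real (v (r2, s2)) \<noteq> 1"
      using v_pos v_ne by (simp_all add: divide_eq_1_iff)
    show "A l \<noteq> 0 \<and> degree (A l) \<le> K" if "l \<in> \<Lambda>" for l
    proof
      show "A l \<noteq> 0" using that by (simp add: \<Lambda>_def)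
      show "degree (A l) \<le> K"
        unfolding A_def
      proof (rule degree_sum_le)
        show "degree (smult (real_of_int (c (k, l))) (binom_poly k)) \<le> K" if "k \<in> {..<K}" for k
          using that degree_binom_poly_le[of k] degree_smult_le[of "real_of_int (c (k, l))" "binom_poly k"]
          by simp
      qed simp
    qed
  next
    fix x w i assume "(x, w) \<in> E" and i: "i \<le> n"
    then obtain r s where rs': "(r, s) \<in> Cl" and x: "x = real (s + (L - 1) * s2)"
      and w: "w = real (v (r, s) * v (r2, s2) ^ (L - 1))"
      by (auto simp: E_def)
    define j where "j = L - 1 - i"
    have j: "L - 1 = i + j" using i n by (simp add: j_def)
    define r' s' where "r' = r + i * r1 + j * r2" and "s' = s + i * s1 + j * s2"
    have v': "v (r', s') = v (r, s) * v (r1, s1) ^ i * v (r2, s2) ^ j"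
      by (simp add: v_def r'_def s'_def power_add power_mult_distrib mult_ac flip: power_mult)
    have "i * r1 + j * r2 \<le> (i + j) * R" "i * s1 + j * s2 \<le> (i + j) * S"
      unfolding add_mult_distrib using rs by (auto intro!: add_mono mult_le_mono)
    moreover have "(i + j) * R \<le> L * R" "(i + j) * S \<le> L * S"
      using j by (intro mult_le_mono; simp)+
    moreover have "r < L * R" "s < L * S"
      using rs' by (auto simp: Cl_def Box_def)
    ultimately have le: "r' \<le> 2 * L * R" "s' \<le> 2 * L * S"
      unfolding r'_def s'_def mult.assoc[of 2] by linarith+
    have "[v (r', s') = b * v (r2, s2) ^ i * v (r2, s2) ^ j] (mod p)"
      unfolding v' using v12 rs' by (intro cong_mult cong_pow cong_refl) (auto simp: Cl_def cong_def)
    then have "[v (r', s') = b * v (r2, s2) ^ (L - 1)] (mod p)"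
      by (simp only: j power_add mult.assoc)
    then have "[int (v (r', s')) = \<xi>] (mod int p)"
      unfolding \<xi>_def by (simp only: cong_int_iff)
    then have z: "F c s' (v (r', s')) = 0"
      using le by (rule zero)
    have e1: "x + real i * (real s1 - real s2) = real s'"
      unfolding x s'_def j by (simp add: algebra_simps)
    have e2: "w * (real (v (r1, s1)) / real (v (r2, s2))) ^ i = real (v (r', s'))"
      using v_pos[of "(r2, s2)"] unfolding w v' j by (simp add: power_add power_divide)
    show "w > 0 \<and> (\<Sum>l\<in>\<Lambda>. poly (A l) (x + real i * (real s1 - real s2)) *
        (w * (real (v (r1, s1)) / real (v (r2, s2))) ^ i) ^ l) = 0"
      unfolding e1 e2 A_sum z using v_pos by (simp add: w)
  qed
  \<comment> \<open>Two pairs of \<open>Cl\<close> with the same \<open>s\<close> would give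
    \<open>q ^ (r - r') = 1\<close> modulo \<open>p\<close> with a positive exponent below
    \<open>L * R\<close>, against \<open>ord\<close>.\<close>
  moreover have "card (fst ` E) = card Cl"
  proof -
    have "inj_on (\<lambda>(r, s). real (s + (L - 1) * s2)) Cl"
    proof (rule inj_onI, clarsimp)
      fix r r' s assume rr: "(r, s) \<in> Cl" "(r', s) \<in> Cl"
      have "r \<le> r'" if rr: "(r, s) \<in> Cl" "(r', s) \<in> Cl" for r r'
      proof (rule ccontr)
        assume "\<not> r \<le> r'"
        then have d: "r = (r - r') + r'" "0 < r - r'" by auto
        have "[v (r, s) = v (r', s)] (mod p)"
          using rr by (simp add: Cl_def cong_def)
        moreover have "v (r, s) = q ^ (r - r') * v (r', s)"
          unfolding v_def case_prod_conv by (metis d(1) mult.assoc power_add)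
        ultimately have "[q ^ (r - r') * v (r', s) = 1 * v (r', s)] (mod p)"
          by (simp only: mult_1)
        then have "[q ^ (r - r') = 1] (mod p)"
          using cop_v cong_mult_rcancel_nat by blast
        moreover have "r - r' < L * R"
          using rr by (auto simp: Cl_def Box_def)
        ultimately show False using ord[OF d(2)] by blast
      qed
      then show "r = r'" using rr by (metis le_antisym)
    qed
    moreover have "fst ` E = (\<lambda>(r, s). real (s + (L - 1) * s2)) ` Cl"
      by (auto simp: E_def image_image case_prod_unfold)
    ultimately show ?thesis by (simp add: card_image)
  qed
  ultimately have "2 ^ L * K < 2 ^ n * K"
    using b unfolding Cl_def by linarith
  moreover have "(2::nat) ^ n \<le> 2 ^ L"
    using n by (intro power_increasing) auto
  ultimately show False
    using mult_le_mono1[of "2 ^ n" "2 ^ L" K] by linarith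
qed

section \<open>Lifting the exponent\<close>

lemma geometric_sum_mult:
  fixes Q :: "'a :: comm_semiring_1"
  shows "(\<Sum>i<a * b. Q ^ i) = (\<Sum>i<a. Q ^ i) * (\<Sum>j<b. (Q ^ a) ^ j)"
proof -
  have "(\<Sum>i<a * b. Q ^ i) = (\<Sum>j<b. \<Sum>i\<in>{j * a..<j * a + a}. Q ^ i)"
    by (simp add: sum.nat_group mult.commute)
  also have "\<dots> = (\<Sum>j<b. (\<Sum>i<a. Q ^ i) * (Q ^ a) ^ j)"
  proof (rule sum.cong)
    fix j
    have "(Q ^ a) ^ j = Q ^ (j * a)"
      by (simp only: power_mult mult.commute[of j])
    then show "(\<Sum>i\<in>{j * a..<j * a + a}. Q ^ i) = (\<Sum>i<a. Q ^ i) * (Q ^ a) ^ j"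
      by (subst sum.atLeastLessThan_shift_0)
        (simp add: power_add sum_distrib_right lessThan_atLeast0 mult.commute[of "Q ^ (j * a)"])
  qed simp
  finally show ?thesis
    by (simp add: sum_distrib_left)
qed

text \<open>For odd \<open>p\<close> and \<open>Q = 1 + p * t\<close>, \<open>Q ^ i\<close> is
  \<open>1 + i * p * t\<close> modulo \<open>p ^ 2\<close>, and the sum of the \<open>i < p\<close>
  is a multiple of \<open>p\<close>, so the whole is \<open>p\<close> modulo \<open>p ^ 2\<close>.
  For \<open>p = 2\<close> the sum \<open>1 + Q\<close> is 2 modulo 4 exactly if \<open>Q\<close> is
  1 modulo 4.\<close>

lemma multiplicity_geometric_prime:
  fixes p Q :: nat
  assumes p: "prime p" and Q: "[Q = 1] (mod p)" and Q2: "p = 2 \<Longrightarrow> [Q = 1] (mod 4)"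
  shows "multiplicity p (\<Sum>i<p. Q ^ i) = 1"
proof -
  have p2: "p \<ge> 2" using p by (rule prime_ge_2_nat)
  have "[(\<Sum>i<p. Q ^ i) = p] (mod p ^ 2)"
  proof (cases "p = 2")
    case True
    then show ?thesis
      using cong_add[OF cong_refl[of 1] Q2[OF True]] by (simp add: eval_nat_numeral)
  next
    case False
    then have odd: "odd p" using p prime_odd_nat p2 by force
    have "Q \<noteq> 0"
      using Q p2 by (intro notI) (simp add: cong_def)
    then have "p dvd Q - 1"
      using Q by (subst (asm) cong_altdef_nat) auto
    then obtain t where "Q - 1 = p * t" by (elim dvdE)
    then have t: "Q = 1 + p * t"
      using \<open>Q \<noteq> 0\<close> by simp
    have pow: "[Q ^ i = 1 + i * (p * t)] (mod p ^ 2)" for i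
    proof (induction i)
      case (Suc i)
      have "[Q ^ Suc i = Q * (1 + i * (p * t))] (mod p ^ 2)"
        using cong_scalar_left[OF Suc, of Q] by simp
      also have "Q * (1 + i * (p * t)) = 1 + Suc i * (p * t) + (i * t * t) * p ^ 2"
        by (simp add: t algebra_simps power2_eq_square)
      also have "[\<dots> = 1 + Suc i * (p * t)] (mod p ^ 2)"
        by (simp add: cong_def)
      finally show ?case .
    qed simp
    have "[(\<Sum>i<p. Q ^ i) = (\<Sum>i<p. 1 + i * (p * t))] (mod p ^ 2)"
      by (intro cong_sum pow)
    also have "(\<Sum>i<p. 1 + i * (p * t)) = p + (\<Sum>i<p. i) * (p * t)"
      by (simp only: sum.distrib sum_distrib_right) simp
    also have "(\<Sum>i<p. i) = p * ((p - 1) div 2)"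
      using odd by (simp add: lessThan_atLeast0 Sum_Ico_nat div_mult_swap)
    also have "p + p * ((p - 1) div 2) * (p * t) = p + ((p - 1) div 2) * t * p ^ 2"
      by (simp add: power2_eq_square)
    also have "[\<dots> = p] (mod p ^ 2)"
      by (simp add: cong_def)
    finally show ?thesis .
  qed
  then have c: "d dvd p ^ 2 \<Longrightarrow> d dvd (\<Sum>i<p. Q ^ i) \<longleftrightarrow> d dvd p" for d
    by (meson cong_dvd_iff cong_dvd_modulus_nat)
  show ?thesis
  proof (rule multiplicity_eqI)
    show "p ^ 1 dvd (\<Sum>i<p. Q ^ i)" using c[of p] by simp
    show "\<not> p ^ Suc 1 dvd (\<Sum>i<p. Q ^ i)"
      using c[of "p ^ 2"] p2 by (auto simp: power2_eq_square dest: dvd_imp_le)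
  qed
qed

text \<open>Factors \<open>p\<close> are removed from \<open>m\<close> one at a time, each
  contributing exactly one, with \<open>Q\<close> replaced by \<open>Q ^ p\<close>. Once
  \<open>p\<close> does not divide \<open>m\<close>, the sum is congruent to \<open>m\<close> modulo
  \<open>p\<close>.\<close>

lemma multiplicity_geometric_sum:
  fixes p Q :: nat
  assumes p: "prime p" and "[Q = 1] (mod p)" and "p = 2 \<Longrightarrow> [Q = 1] (mod 4)" and "m > 0"
  shows "multiplicity p (\<Sum>i<m. Q ^ i) = multiplicity p m"
  using assms(2-)
proof (induction m arbitrary: Q rule: less_induct)
  case (less m)
  show ?case
  proof (cases "p dvd m")
    case False
    have "[(\<Sum>i<m. Q ^ i) = (\<Sum>i<m. 1 ^ i)] (mod p)"
      using less.prems(1) by (intro cong_sum cong_pow)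
    then have "\<not> p dvd (\<Sum>i<m. Q ^ i)"
      using False by (simp add: cong_dvd_iff)
    then show ?thesis
      using False by (simp add: not_dvd_imp_multiplicity_0)
  next
    case True
    then obtain k where m: "m = p * k" by blast
    have k: "k > 0" "k < m"
      using less.prems(3) m prime_gt_1_nat[OF p] by auto
    have IH: "multiplicity p (\<Sum>j<k. (Q ^ p) ^ j) = multiplicity p k"
    proof (rule less.IH)
      show "[Q ^ p = 1] (mod p)"
        using cong_pow[OF less.prems(1), of p] by simp
      show "[Q ^ p = 1] (mod 4)" if "p = 2"
        using cong_pow[OF less.prems(2)[OF that], of p] by simp
    qed (use k in auto)
    have "Q > 0"
      using less.prems(1) prime_gt_1_nat[OF p] by (intro gr0I) (simp add: cong_def)
    then have pos: "(\<Sum>j<k. (Q ^ p) ^ j) > 0" "(\<Sum>j<p. Q ^ j) > 0"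
      using k p by (auto intro!: sum_pos simp: prime_gt_0_nat lessThan_empty_iff)
    have "multiplicity p (\<Sum>i<m. Q ^ i)
        = multiplicity p (\<Sum>i<p. Q ^ i) + multiplicity p (\<Sum>j<k. (Q ^ p) ^ j)"
      unfolding m geometric_sum_mult using p pos
      by (metis not_less_zero prime_elem_multiplicity_mult_distrib prime_imp_prime_elem)
    also have "\<dots> = multiplicity p p + multiplicity p k"
      using multiplicity_geometric_prime[OF p less.prems(1,2)] IH p by (simp add: multiplicity_self)
    also have "\<dots> = multiplicity p m"
      unfolding m using p k by (intro prime_elem_multiplicity_mult_distrib[symmetric]) auto
    finally show ?thesis .
  qed
qed

text \<open>For \<open>p = 2\<close> the exponent is 2, since lifting the exponent needs a base that is 1 modulo 4.\<close>

definition fermat_val :: "nat \<Rightarrow> nat \<Rightarrow> nat" where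
  "fermat_val p q = multiplicity p (q ^ (if p = 2 then 2 else p - 1) - 1)"

lemma power_minus_1_dvd:
  fixes q :: nat
  shows "q ^ a - 1 dvd q ^ (a * b) - 1"
proof (cases "q = 0")
  case False
  have "[(q ^ a) ^ b = 1 ^ b] (mod (q ^ a - 1))"
    using False by (intro cong_pow) (simp add: cong_altdef_nat)
  then show ?thesis
    using False by (simp add: cong_altdef_nat power_mult)
qed (simp add: power_0_left)

lemma power_minus_1_geometric:
  fixes q :: nat
  shows "(q - 1) * (\<Sum>i<m. q ^ i) = q ^ m - 1"
proof (cases "q = 0")
  case False
  then have "int ((q - 1) * (\<Sum>i<m. q ^ i)) = int (q ^ m - 1)"
    using power_diff_1_eq[of "int q" m] by (simp add: of_nat_diff)
  then show ?thesis by (simp only: of_nat_eq_iff)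
qed (cases m; simp)

text \<open>The base \<open>q\<close> itself may not be 1 modulo \<open>p\<close>, but the sum
  divides \<open>q ^ (m * g) - 1 = (Q - 1) * (\<Sum>i<m. Q ^ i)\<close>, where
  \<open>Q = q ^ g\<close> is a base to which lifting the exponent applies.\<close>

lemma multiplicity_geometric_sum_le:
  assumes p: "prime p" and q: "prime q" and "p \<noteq> q" and m: "m > 0"
  shows "multiplicity p (\<Sum>i<m. q ^ i) \<le> fermat_val p q + multiplicity p m"
proof -
  define g where "g = (if p = 2 then 2 else p - 1)"
  define Q where "Q = q ^ g"
  have g: "g > 0" using prime_gt_1_nat[OF p] by (simp add: g_def)
  have cop: "\<not> p dvd q" using p q assms(3) primes_dvd_imp_eq by blast
  have Q4: "[Q = 1] (mod 4)" if "p = 2"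
  proof -
    have "odd q" using cop that by simp
    then obtain t where "q = 2 * t + 1" by (elim oddE)
    then have "Q = 1 + 4 * (t * t + t)"
      using that by (simp add: Q_def g_def power2_eq_square algebra_simps)
    then show ?thesis by (simp add: cong_def)
  qed
  have Q1: "[Q = 1] (mod p)"
  proof (cases "p = 2")
    case True
    show ?thesis
      using cong_dvd_modulus_nat[OF Q4[OF True], of 2] True by simp
  next
    case False
    then show ?thesis using fermat_theorem[OF p cop] by (simp add: Q_def g_def)
  qed
  have Q_gt: "Q > 1"
    unfolding Q_def using g prime_gt_1_nat[OF q] by (intro one_less_power)
  have "(\<Sum>i<m. q ^ i) dvd q ^ (m * g) - 1"
    using power_minus_1_geometric[of q m] power_minus_1_dvd[of q m g] by (metis dvd_trans dvd_triv_right)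
  also have "q ^ (m * g) - 1 = (Q - 1) * (\<Sum>i<m. Q ^ i)"
    by (simp only: power_minus_1_geometric Q_def power_mult mult.commute[of m])
  finally have "multiplicity p (\<Sum>i<m. q ^ i) \<le> multiplicity p ((Q - 1) * (\<Sum>i<m. Q ^ i))"
    using Q_gt m by (intro dvd_imp_multiplicity_le) (auto simp: sum_eq_0_iff)
  also have "\<dots> = fermat_val p q + multiplicity p m"
    using Q_gt m p multiplicity_geometric_sum[OF p Q1 Q4 m]
    by (subst prime_elem_multiplicity_mult_distrib) (auto simp: fermat_val_def Q_def g_def)
  finally show ?thesis .
qed

section \<open>Size bounds for valuations\<close>

lemma multiplicity_ln_le:
  assumes "prime p" and "n > 0"
  shows "real (multiplicity p n) * ln (real p) \<le> ln (real n)"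
proof -
  have "p ^ multiplicity p n \<le> n"
    using assms by (intro dvd_imp_le multiplicity_dvd) auto
  then have "real p ^ multiplicity p n \<le> real n"
    by (metis of_nat_le_iff of_nat_power)
  then have "ln (real p ^ multiplicity p n) \<le> ln (real n)"
    using prime_gt_0_nat[OF assms(1)] by (subst ln_le_cancel_iff) (use assms in auto)
  then show ?thesis
    using prime_gt_0_nat[OF assms(1)] by (simp add: ln_realpow)
qed

lemma multiplicity_power_minus_1_ln_le:
  assumes "prime p" and "prime q" and "g > 0"
  shows "real (multiplicity p (q ^ g - 1)) * ln (real p) \<le> real g * ln (real q)"
proof -
  have "q ^ g > 1" using assms prime_gt_1_nat[of q] by (intro one_less_power) auto
  then have "real (multiplicity p (q ^ g - 1)) * ln (real p) \<le> ln (real (q ^ g - 1))"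
    using assms by (intro multiplicity_ln_le) auto
  also have "\<dots> \<le> ln (real (q ^ g))"
    using \<open>q ^ g > 1\<close> prime_gt_0_nat[OF assms(2)]
    by (subst ln_le_cancel_iff) (simp_all add: less_imp_le del: of_nat_power)
  finally show ?thesis
    using prime_gt_0_nat[OF assms(2)] by (simp add: ln_realpow)
qed

section \<open>A bound for Fermat quotients\<close>

lemma nat_floor_bounds:
  fixes x :: real
  assumes "x \<ge> 1"
  shows "x / 2 \<le> real (nat \<lfloor>x\<rfloor>)" and "real (nat \<lfloor>x\<rfloor>) \<le> x"
proof -
  have "real (nat \<lfloor>x\<rfloor>) = real_of_int \<lfloor>x\<rfloor>" using assms by simp
  moreover have "real_of_int \<lfloor>x\<rfloor> \<ge> 1" using assms by simp
  ultimately show "x / 2 \<le> real (nat \<lfloor>x\<rfloor>)" "real (nat \<lfloor>x\<rfloor>) \<le> x"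
    by linarith+
qed

lemma ln_sq_le:
  fixes x :: real
  assumes "x \<ge> 1"
  shows "(ln x)\<^sup>2 \<le> 4 * x"
proof -
  have "ln x = 2 * ln (sqrt x)" using assms by (simp add: ln_sqrt)
  also have "\<dots> \<le> 2 * sqrt x"
    using assms ln_le_minus_one[of "sqrt x"] by simp
  finally have "(ln x)\<^sup>2 \<le> (2 * sqrt x)\<^sup>2"
    using assms by (intro power_mono) auto
  then show ?thesis using assms by (simp add: power_mult_distrib)
qed

lemma ln_prime_bounds:
  assumes "prime (p :: nat)"
  shows "ln (real p) \<ge> 1 / 2" and "ln (real p) \<le> real p - 1"
    and "ln (real p) > 0"
proof -
  have "1 / 2 \<le> ln (2 :: real)"
    using ln_le_minus_one[of "1 / 2 :: real"] by (simp add: ln_div)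
  also have "\<dots> \<le> ln (real p)"
    using prime_ge_2_nat[OF assms] by (subst ln_le_cancel_iff) auto
  finally show "ln (real p) \<ge> 1 / 2" .
  then show "ln (real p) > 0" by simp
  show "ln (real p) \<le> real p - 1"
    using prime_gt_0_nat[OF assms] by (intro ln_le_minus_one) simp
qed

text \<open>Both numbers divide \<open>q ^ (g * j) - 1\<close>, and passing from
  \<open>q ^ j\<close> to its \<open>g\<close>-th power adds no factor \<open>p\<close>. This serves
  to rule out a small order of \<open>q\<close> modulo \<open>p\<close> when the valuation is
  high.\<close>

lemma multiplicity_power_minus_1_le_of_cong:
  fixes p q j g :: nat
  assumes p: "prime p" "p \<noteq> 2" and q: "q > 1" and j: "j > 0" "[q ^ j = 1] (mod p)"
    and g: "g > 0" "\<not> p dvd g"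
  shows "multiplicity p (q ^ g - 1) \<le> multiplicity p (q ^ j - 1)"
proof -
  have gt: "q ^ (g * j) > 1" "q ^ j > 1"
    using q j g by (intro one_less_power; simp)+
  have "q ^ (g * j) - 1 = (q ^ j - 1) * (\<Sum>i<g. (q ^ j) ^ i)"
    by (simp only: power_minus_1_geometric power_mult mult.commute[of g])
  moreover have "(q ^ j - 1) > 0" "(\<Sum>i<g. (q ^ j) ^ i) > 0"
    using gt calculation by (auto intro!: Nat.gr0I)
  ultimately have "multiplicity p (q ^ (g * j) - 1)
      = multiplicity p (q ^ j - 1) + multiplicity p (\<Sum>i<g. (q ^ j) ^ i)"
    using p by (metis not_less_zero prime_elem_multiplicity_mult_distrib prime_imp_prime_elem)
  also have "multiplicity p (\<Sum>i<g. (q ^ j) ^ i) = 0"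
    using multiplicity_geometric_sum[OF p(1) j(2) _ g(1)] p(2) g(2)
    by (simp add: not_dvd_imp_multiplicity_0)
  finally have "multiplicity p (q ^ (g * j) - 1) = multiplicity p (q ^ j - 1)"
    by simp
  moreover have "multiplicity p (q ^ g - 1) \<le> multiplicity p (q ^ (g * j) - 1)"
    using gt power_minus_1_dvd[of q g j] by (intro dvd_imp_multiplicity_le) auto
  ultimately show ?thesis by simp
qed

text \<open>The trivial bound by size. The factor 2 serves \<open>p = 2\<close>, where the exponent
  is 2 instead of \<open>p - 1\<close>.\<close>

lemma fermat_val_ln_le:
  assumes "prime p" and "prime q"
  shows "real (fermat_val p q) * ln (real p) \<le> 2 * (real p - 1) * ln (real q)"
proof -
  define g where "g = (if p = 2 then 2 else p - 1)"
  have p: "p \<ge> 2" using assms(1) by (rule prime_ge_2_nat)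
  have "real (fermat_val p q) * ln (real p) \<le> real g * ln (real q)"
    unfolding fermat_val_def g_def[symmetric] using p assms
    by (intro multiplicity_power_minus_1_ln_le) (auto simp: g_def)
  also have "\<dots> \<le> 2 * (real p - 1) * ln (real q)"
    using p ln_prime_bounds[OF assms(2)] by (intro mult_right_mono) (auto simp: g_def of_nat_diff)
  finally show ?thesis .
qed

text \<open>The interpolation argument with \<open>L = 20\<close>. Both \<open>R * ln q\<close> and
  \<open>S\<close> are within a factor 2 of \<open>K * ln p / 1000\<close>, small enough for the
  size condition, while \<open>K\<close> is large enough for the two counting conditions.\<close>

lemma fermat_val_large_prime:
  assumes p: "prime p" and q: "prime q" and pq: "p \<noteq> q" and p40: "p \<ge> 40"
  shows "real (fermat_val p q) * (ln (real p))\<^sup>2 \<le> 640000000000 * (real p - 1) * ln (real q)"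
proof -
  define P l m where "P = real p" and "l = ln (real p)" and "m = ln (real q)"
  \<comment> \<open>Counting needs \<open>400 * R * S > 2 ^ 20 * K * p\<close>, so
    \<open>R * S\<close> above about \<open>2622 * K * p\<close>. As \<open>R * S\<close> is at
    least \<open>K * K * l * l / (4000000 * m)\<close>, this constant yields
    \<open>5000 * K * p\<close>.\<close>
  define X where "X = 20000000000 * (P * m / l\<^sup>2)"
  define K where "K = nat \<lceil>X\<rceil>"
  define R where "R = nat \<lfloor>real K * l / (1000 * m)\<rfloor>"
  define S where "S = nat \<lfloor>real K * l / 1000\<rfloor>"
  have P: "P \<ge> 40" using p40 by (simp add: P_def)
  have l: "l \<ge> 1 / 2" "l \<le> P" and m: "m \<ge> 1 / 2"
    using ln_prime_bounds[OF p] ln_prime_bounds[OF q] by (simp_all add: l_def m_def P_def)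
  have l2: "l\<^sup>2 \<le> 4 * P"
    using ln_sq_le[of P] P by (simp add: l_def P_def)
  have "X \<ge> 1"
  proof -
    have "l\<^sup>2 * 1 \<le> 4 * P * (2 * m)"
      using l2 m P by (intro mult_mono) auto
    then have "P * m / l\<^sup>2 \<ge> 1 / 8" using l by (simp add: field_simps)
    then show ?thesis by (simp add: X_def)
  qed
  then have K: "real K \<ge> X" "real K \<le> 2 * X" "K > 0"
    by (auto simp: K_def) linarith+
  have Kl: "real K * l\<^sup>2 \<ge> 20000000000 * (P * m)"
    using K(1) l by (simp add: X_def field_simps)
  have V: "real (fermat_val p q) \<le> 8 * real K"
  proof (rule ccontr)
    assume "\<not> ?thesis"
    then have V8: "8 * K < fermat_val p q" by simp
    have p2: "p \<noteq> 2" using p40 by simp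
    have "20000000000 * m * l \<le> (real K * l) * l"
    proof -
      have "20000000000 * m * l \<le> 20000000000 * m * P"
        using l m by (intro mult_left_mono) auto
      then show ?thesis using Kl by (simp add: power2_eq_square mult_ac)
    qed
    then have Kl1: "20000000000 * m \<le> real K * l"
      using l by (simp add: mult_le_cancel_right)
    have R: "real K * l / (2000 * m) \<le> real R" "real R \<le> real K * l / (1000 * m)"
    proof -
      have "real K * l / (1000 * m) \<ge> 1" using Kl1 m by (simp add: field_simps)
      from nat_floor_bounds[OF this] show "real K * l / (2000 * m) \<le> real R" "real R \<le> real K * l / (1000 * m)"
        by (simp_all add: R_def)
    qed
    have S: "real K * l / 2000 \<le> real S" "real S \<le> real K * l / 1000"
    proof -
      have "real K * l / 1000 \<ge> 1" using Kl1 m by simp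
      from nat_floor_bounds[OF this] show "real K * l / 2000 \<le> real S" "real S \<le> real K * l / 1000"
        by (simp_all add: S_def)
    qed
    have RS: "5000 * (real K * P) \<le> real R * real S"
    proof -
      have "20000000000 * (P * m) * real K \<le> real K * l\<^sup>2 * real K"
        using Kl by (intro mult_right_mono) auto
      then have "5000 * (real K * P) \<le> real K * l / (2000 * m) * (real K * l / 2000)"
        using m by (simp add: field_simps power2_eq_square)
      also have "\<dots> \<le> real R * real S"
        using R S l m by (intro mult_mono) auto
      finally show ?thesis .
    qed
    have KP: "real K * P \<ge> P" "P > 0" using K(3) P by auto
    have dvd: "p ^ (8 * K) dvd q ^ (p - 1) - 1"
      using V8 p2 by (intro multiplicity_dvd') (simp add: fermat_val_def)
    have q1: "q ^ (p - 1) \<ge> 1" using prime_gt_0_nat[OF q] by simp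
    have qT: "[int q ^ (p - 1) = 1] (mod int p ^ (8 * K))"
    proof -
      have "[q ^ (p - 1) = 1] (mod p ^ (8 * K))"
        using dvd q1 by (subst cong_altdef_nat) auto
      then show ?thesis by (simp flip: cong_int_iff)
    qed
    define y :: nat where "y = (if q = 2 then 3 else 2)"
    have y: "prime y" "y \<noteq> p" "q \<noteq> y" "ln (real y) \<le> 2" "y > 0"
      using p40 ln_le_minus_one[of "real y"] by (auto simp: y_def)
    \<comment> \<open>Otherwise \<open>q ^ j - 1\<close> already contains more than
      \<open>8 * K\<close> factors \<open>p\<close>, although its logarithm is at most
      \<open>20 * R * m \<le> K * l / 50\<close>.\<close>
    have ord: "\<not> [q ^ j = 1] (mod p)" if j: "0 < j" "j < 20 * R" for j
    proof
      assume "[q ^ j = 1] (mod p)"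
      moreover have "\<not> p dvd p - 1"
        using p40 by (auto dest: dvd_imp_le)
      ultimately have "fermat_val p q \<le> multiplicity p (q ^ j - 1)"
        using multiplicity_power_minus_1_le_of_cong[of p q j "p - 1"] p p2 p40 prime_gt_1_nat[OF q] j
        by (simp add: fermat_val_def)
      then have "8 * real K \<le> real (multiplicity p (q ^ j - 1))"
        using V8 by simp
      then have "8 * real K * l \<le> real (multiplicity p (q ^ j - 1)) * l"
        using l by (intro mult_right_mono) auto
      also have "\<dots> \<le> real j * m"
        using multiplicity_power_minus_1_ln_le[OF p q j(1)] by (simp add: l_def m_def)
      also have "\<dots> \<le> (20 * (real K * l / (1000 * m))) * m"
      proof (rule mult_right_mono)
        have "real j \<le> 20 * real R" using j(2) by simp
        also have "\<dots> \<le> 20 * (real K * l / (1000 * m))" using R(2) by (intro mult_left_mono) auto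
        finally show "real j \<le> 20 * (real K * l / (1000 * m))" .
      qed (use m in simp)
      also have "\<dots> = real K * l / 50"
        using m by simp
      finally show False
        using Kl1 m by (simp add: mult.commute)
    qed
    have cnt: "p * (2 ^ 20 * K) < (20 * R) * (20 * S)"
    proof -
      have "real (p * (2 ^ 20 * K)) = 1048576 * (real K * P)"
        "real ((20 * R) * (20 * S)) = 400 * (real R * real S)"
        by (simp_all add: P_def)
      then have "real (p * (2 ^ 20 * K)) < real ((20 * R) * (20 * S))"
        using RS KP by linarith
      then show ?thesis by (simp only: of_nat_less_iff)
    qed
    have cnt': "p < R * S"
    proof -
      have "real p < real (R * S)"
        using RS KP unfolding P_def of_nat_mult by linarith
      then show ?thesis by (simp only: of_nat_less_iff)
    qed
    \<comment> \<open>In units of \<open>K * l\<close>, the logarithm of \<open>K * 20\<close> costs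
      at most 1 because \<open>20 * K \<le> 40 ^ K\<close>, and the other factors at most 0.04, 0.8
      and 1.6: in total less than 4.\<close>
    have size: "K * 20 * 2 ^ (2 * 20 * S) * (q ^ (2 * 20 * R) * y ^ (2 * 20 * S)) ^ 20 < p ^ (4 * K)"
      (is "?A < _")
    proof -
      have pos: "real K > 0" "real q > 0" "real y > 0" "real p > 0"
        using K(3) prime_gt_0_nat[OF q] prime_gt_0_nat[OF p] y(5) by auto
      have lnA: "ln (real ?A) = ln (real K * 20) + 40 * (real S * ln 2) + 800 * (real R * m) + 800 * (real S * ln (real y))"
        using pos by (simp add: ln_mult ln_realpow m_def algebra_simps)
      have "K * 20 \<le> p ^ K"
      proof -
        have "K * 20 \<le> 2 ^ K * 20 ^ K"
          using K(3) by (intro mult_le_mono) (auto simp: less_imp_le self_le_power)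
        also have "\<dots> = 40 ^ K" by (simp flip: power_mult_distrib)
        also have "\<dots> \<le> p ^ K" using p40 by (rule power_mono) simp
        finally show ?thesis .
      qed
      then have "real K * 20 \<le> real p ^ K"
        by (metis of_nat_le_iff of_nat_mult of_nat_numeral of_nat_power)
      then have "ln (real K * 20) \<le> ln (real p ^ K)"
        using pos by (subst ln_le_cancel_iff) auto
      then have a: "ln (real K * 20) \<le> real K * l"
        using pos by (simp add: ln_realpow l_def)
      have b: "real S * ln 2 \<le> real K * l / 1000 * 1"
        using S(2) ln_le_minus_one[of "2::real"] l by (intro mult_mono) auto
      have c: "real S * ln (real y) \<le> real K * l / 1000 * 2"
        using S(2) y(4,5) l by (intro mult_mono) auto
      have d: "real R * m \<le> real K * l / 1000"
        using mult_right_mono[OF R(2), of m] m by simp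
      have "real K * l > 0" using K(3) l by simp
      then have "ln (real ?A) < 4 * (real K * l)"
        using a b c d unfolding lnA by linarith
      also have "\<dots> = ln (real (p ^ (4 * K)))"
        using pos by (simp add: ln_realpow l_def)
      finally have "real ?A < real (p ^ (4 * K))"
        using pos by (subst (asm) ln_less_cancel_iff) (auto simp: K(3))
      then show ?thesis by (simp only: of_nat_less_iff)
    qed
    show False
      using interpolation_contradiction[OF p q y(1) pq[symmetric] y(2,3) K(3) _ qT ord cnt cnt' size]
      by simp
  qed
  \<comment> \<open>The last doubling of the constant comes from
    \<open>P \<le> 2 * (P - 1)\<close>.\<close>
  have "real (fermat_val p q) * l\<^sup>2 \<le> 8 * (2 * X) * l\<^sup>2"
    using V K(2) by (intro mult_right_mono) auto
  also have "\<dots> = 320000000000 * (P * m)"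
    using l by (simp add: X_def)
  also have "\<dots> \<le> 320000000000 * ((2 * (P - 1)) * m)"
    using P m by (intro mult_left_mono mult_right_mono) auto
  finally show ?thesis
    by (simp add: P_def l_def m_def mult_ac)
qed

text \<open>For \<open>p < 40\<close> the trivial bound is enough, since the extra factor
  \<open>ln p\<close> is below 40.\<close>

lemma fermat_val_bound:
  assumes p: "prime p" and q: "prime q" and "p \<noteq> q"
  shows "real (fermat_val p q) * (ln (real p))\<^sup>2 \<le> 640000000000 * (real p - 1) * ln (real q)"
proof (cases "p \<ge> 40")
  case True
  then show ?thesis using assms by (intro fermat_val_large_prime)
next
  case False
  have "real (fermat_val p q) * (ln (real p))\<^sup>2 = (real (fermat_val p q) * ln (real p)) * ln (real p)"
    by (simp add: power2_eq_square)
  also have "\<dots> \<le> (2 * (real p - 1) * ln (real q)) * 40"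
    using False ln_prime_bounds[OF p] ln_prime_bounds[OF q]
    by (intro mult_mono[OF fermat_val_ln_le[OF p q]]) auto
  also have "\<dots> = 80 * ((real p - 1) * ln (real q))" by simp
  also have "\<dots> \<le> 640000000000 * ((real p - 1) * ln (real q))"
    using ln_prime_bounds[OF p] ln_prime_bounds[OF q] by (intro mult_right_mono) auto
  finally show ?thesis by (simp only: mult.assoc)
qed

section \<open>The fundamental inequality for the abundancy index\<close>

lemma sum_multiplicity_ln_le:
  fixes A :: "nat set"
  assumes "finite A" and "\<And>p. p \<in> A \<Longrightarrow> prime p" and "m > 0"
  shows "(\<Sum>p\<in>A. real (multiplicity p m) * ln (real p)) \<le> ln (real m)"
proof -
  have "(\<Sum>p\<in>A. real (multiplicity p m) * ln (real p))
      = (\<Sum>p\<in>A \<inter> prime_factors m. real (multiplicity p m) * ln (real p))"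
  proof (rule sum.mono_neutral_right)
    show "\<forall>p\<in>A - A \<inter> prime_factors m. real (multiplicity p m) * ln (real p) = 0"
      using assms by (auto simp: prime_factors_dvd not_dvd_imp_multiplicity_0)
  qed (use assms in auto)
  also have "\<dots> \<le> (\<Sum>p\<in>prime_factors m. real (multiplicity p m) * ln (real p))"
  proof (rule sum_mono2)
    show "0 \<le> real (multiplicity p m) * ln (real p)" if "p \<in> prime_factors m - A \<inter> prime_factors m" for p
      using that ln_prime_bounds(3)[of p] by (auto simp: less_imp_le in_prime_factors_iff)
  qed auto
  also have "\<dots> = ln (\<Prod>p\<in>prime_factors m. real p ^ multiplicity p m)"
    by (subst ln_prod) (auto simp: ln_realpow in_prime_factors_iff prime_gt_0_nat)
  also have "(\<Prod>p\<in>prime_factors m. real p ^ multiplicity p m) = real m"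
    using prime_factorization_nat[OF assms(3)] by (metis (mono_tags, lifting) of_nat_power of_nat_prod prod.cong)
  finally show ?thesis .
qed

lemma sum_multiplicity_family_ln_le:
  fixes p :: "'i \<Rightarrow> nat"
  assumes "finite I" and pr: "\<And>i. i \<in> I \<Longrightarrow> prime (p i)" and "inj_on p I" and "m > 0"
  shows "(\<Sum>i\<in>I. real (multiplicity (p i) m) * ln (real (p i))) \<le> ln (real m)"
proof -
  have "(\<Sum>i\<in>I. real (multiplicity (p i) m) * ln (real (p i)))
      = (\<Sum>q\<in>p ` I. real (multiplicity q m) * ln (real q))"
    using assms(3) by (simp add: sum.reindex)
  also have "\<dots> \<le> ln (real m)"
  proof (rule sum_multiplicity_ln_le)
    show "prime q" if "q \<in> p ` I" for q using that pr by blast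
  qed (use assms in auto)
  finally show ?thesis .
qed

section \<open>Divisor sums of products of prime powers\<close>

lemma divisor_sum_mult_coprime:
  assumes "coprime a b" and "a > 0" and "b > 0"
  shows "divisor_sum (a * b) = divisor_sum a * divisor_sum b"
proof -
  have inj: "inj_on (\<lambda>(x, y). x * y) ({x. x dvd a} \<times> {y. y dvd b})"
  proof (rule inj_onI, clarsimp)
    fix x y x' y' assume d: "x dvd a" "y dvd b" "x' dvd a" "y' dvd b" and eq: "x * y = x' * y'"
    have "coprime x y'" "coprime x' y"
      using d assms(1) by (meson coprime_divisors)+
    then have "x dvd x'" "x' dvd x"
      using eq by (metis coprime_dvd_mult_left_iff dvd_triv_left)+
    then have "x = x'" by (rule dvd_antisym)
    moreover have "x > 0" using d(1) assms(2) by (auto intro: Nat.gr0I)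
    ultimately show "x = x' \<and> y = y'" using eq by simp
  qed
  have img: "{z. z dvd a * b} = (\<lambda>(x, y). x * y) ` ({x. x dvd a} \<times> {y. y dvd b})"
  proof (intro equalityI subsetI)
    fix z assume "z \<in> {z. z dvd a * b}"
    then obtain x y where "z = x * y" "x dvd a" "y dvd b"
      using division_decomp[of z a b] by blast
    then show "z \<in> (\<lambda>(x, y). x * y) ` ({x. x dvd a} \<times> {y. y dvd b})"
      by (auto intro!: image_eqI[of _ _ "(x, y)"])
  qed (auto intro: mult_dvd_mono)
  show ?thesis
    unfolding divisor_sum_def img sum.reindex[OF inj] sum_product sum.cartesian_product
    by (simp add: case_prod_unfold)
qed

lemma divisor_sum_prime_power:
  assumes "prime p"
  shows "divisor_sum (p ^ e) = (\<Sum>i<Suc e. p ^ i)"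
proof -
  have "{a. a dvd p ^ e} = (\<lambda>i. p ^ i) ` {..<Suc e}"
    using divides_primepow_nat[OF assms] by (auto simp: image_iff less_Suc_eq_le)
  moreover have "inj_on (\<lambda>i. p ^ i) {..<Suc e}"
    using prime_gt_1_nat[OF assms] by (auto intro!: inj_onI)
  ultimately show ?thesis
    by (simp add: divisor_sum_def sum.reindex)
qed

lemma divisor_sum_prod_prime_powers:
  assumes "finite I" and "\<And>i. i \<in> I \<Longrightarrow> prime (p i)" and "inj_on p I"
  shows "divisor_sum (\<Prod>i\<in>I. p i ^ e i) = (\<Prod>i\<in>I. \<Sum>j<Suc (e i). p i ^ j)"
  using assms
proof (induction I)
  case empty
  then show ?case by (simp add: divisor_sum_def)
next
  case (insert x I)
  have "coprime (p x ^ e x) (\<Prod>i\<in>I. p i ^ e i)"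
    using insert by (intro prod_coprime_right) (auto intro!: primes_coprime)
  moreover have "(\<Prod>i\<in>I. p i ^ e i) > 0" "p x ^ e x > 0"
    using insert by (auto intro!: prod_pos simp: prime_gt_0_nat)
  ultimately show ?case
    using insert by (simp add: divisor_sum_mult_coprime divisor_sum_prime_power)
qed

lemma multiplicity_int: "multiplicity (int p) (int n) = multiplicity p n"
  unfolding multiplicity_def by (simp flip: of_nat_power)

lemma ln_mult_prime_powers:
  assumes "\<And>i. i \<in> I \<Longrightarrow> prime (p i)"
  shows "ln (real (\<Prod>i\<in>I. p i ^ e i)) = (\<Sum>i\<in>I. real (e i) * ln (real (p i)))"
  using assms by (cases "finite I") (simp_all add: ln_prod ln_realpow prime_gt_0_nat)

text \<open>\<open>p i ^ e i\<close> divides \<open>n * N = d * \<sigma>(N)\<close>, while the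
  factor of \<open>\<sigma>(N)\<close> belonging to \<open>p i\<close> is 1 modulo
  \<open>p i\<close>; so \<open>d\<close> and the other factors supply the power. Weighted by
  logarithms, the contributions of \<open>d\<close> total at most \<open>ln d\<close>.\<close>

lemma abundancy_ln_le:
  assumes "abundancy_factorization N n d k p e"
  shows "ln (real N) \<le> ln (real d) + (\<Sum>i=1..k. \<Sum>j\<in>{1..k} - {i}.
           real (fermat_val (p i) (p j) + multiplicity (p i) (e j + 1)) * ln (real (p i)))"
proof -
  have N: "N > 0" "n > 0" "d > 0" "real (divisor_sum N) = real n / real d * real N"
    and pr: "\<And>i. i \<in> {1..k} \<Longrightarrow> prime (p i)" and "strict_mono_on {1..k} p"
    and Nprod: "N = (\<Prod>i=1..k. p i ^ e i)"
    using assms unfolding abundancy_factorization_def by blast+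
  have inj: "inj_on p {1..k}"
    using \<open>strict_mono_on {1..k} p\<close> by (rule strict_mono_on_imp_inj_on)
  define \<sigma> where "\<sigma> = (\<lambda>j. \<Sum>t<Suc (e j). p j ^ t)"
  have "\<sigma> j > 0" for j
    unfolding \<sigma>_def by (rule sum_pos2[of _ 0]) auto
  then have \<sigma>_ne: "\<sigma> j \<noteq> 0" for j
    by (metis less_irrefl)
  have eq: "d * (\<Prod>j=1..k. \<sigma> j) = n * N"
  proof -
    have "real d * real (divisor_sum N) = real n * real N"
      using N by simp
    then have "d * divisor_sum N = n * N"
      by (metis of_nat_eq_iff of_nat_mult)
    then show ?thesis
      using divisor_sum_prod_prime_powers[of "{1..k}" p e] pr inj Nprod by (simp add: \<sigma>_def)
  qed
  have v: "e i \<le> multiplicity (p i) d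
      + (\<Sum>j\<in>{1..k} - {i}. fermat_val (p i) (p j) + multiplicity (p i) (e j + 1))"
    if i: "i \<in> {1..k}" for i
  proof -
    have pe: "prime_elem (p i)" using pr[OF i] by simp
    have "p i ^ e i dvd n * N"
      unfolding Nprod using i by (intro dvd_mult dvd_prodI) auto
    then have "e i \<le> multiplicity (p i) (n * N)"
      using N pr[OF i] by (intro multiplicity_geI) (auto simp: prime_gt_0_nat)
    also have "\<dots> = multiplicity (p i) d + multiplicity (p i) (\<Prod>j=1..k. \<sigma> j)"
      unfolding eq[symmetric] using pe N(3)
      by (intro prime_elem_multiplicity_mult_distrib) (simp_all add: \<sigma>_ne)
    finally have 1: "e i \<le> multiplicity (p i) d + multiplicity (p i) (\<Prod>j=1..k. \<sigma> j)" .
    have "multiplicity (p i) (\<Prod>j=1..k. \<sigma> j) = (\<Sum>j=1..k. multiplicity (p i) (\<sigma> j))"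
      using pe by (intro prime_elem_multiplicity_prod_distrib) (simp_all add: image_iff \<sigma>_ne)
    then have 2: "multiplicity (p i) (\<Prod>j=1..k. \<sigma> j) = multiplicity (p i) (\<sigma> i) + (\<Sum>j\<in>{1..k} - {i}. multiplicity (p i) (\<sigma> j))"
      using i by (simp add: sum.remove)
    have 3: "multiplicity (p i) (\<sigma> i) = 0"
    proof -
      have "\<sigma> i = 1 + p i * (\<Sum>t<e i. p i ^ t)"
        unfolding \<sigma>_def by (subst sum.lessThan_Suc_shift) (simp add: sum_distrib_left)
      then have "\<not> p i dvd \<sigma> i"
        using prime_gt_1_nat[OF pr[OF i]] by (metis dvd_add_left_iff dvd_triv_left nat_dvd_1_iff_1 less_irrefl)
      then show ?thesis by (rule not_dvd_imp_multiplicity_0)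
    qed
    have "(\<Sum>j\<in>{1..k} - {i}. multiplicity (p i) (\<sigma> j))
        \<le> (\<Sum>j\<in>{1..k} - {i}. fermat_val (p i) (p j) + multiplicity (p i) (e j + 1))"
    proof (rule sum_mono)
      fix j assume j: "j \<in> {1..k} - {i}"
      have "p i \<noteq> p j" using inj_onD[OF inj, of i j] i j by blast
      then show "multiplicity (p i) (\<sigma> j) \<le> fermat_val (p i) (p j) + multiplicity (p i) (e j + 1)"
        using multiplicity_geometric_sum_le[OF pr pr, of i j "Suc (e j)"] i j by (simp add: \<sigma>_def)
    qed
    with 1 2 3 show ?thesis by linarith
  qed
  have "ln (real N) = (\<Sum>i=1..k. real (e i) * ln (real (p i)))"
    unfolding Nprod by (rule ln_mult_prime_powers) (use pr in auto)
  also have "\<dots> \<le> (\<Sum>i=1..k. real (multiplicity (p i) d) * ln (real (p i)) + (\<Sum>j\<in>{1..k} - {i}.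
      real (fermat_val (p i) (p j) + multiplicity (p i) (e j + 1)) * ln (real (p i))))"
  proof (rule sum_mono)
    fix i assume i: "i \<in> {1..k}"
    have "real (e i) * ln (real (p i)) \<le> real (multiplicity (p i) d
      + (\<Sum>j\<in>{1..k} - {i}. fermat_val (p i) (p j) + multiplicity (p i) (e j + 1))) * ln (real (p i))"
      using ln_prime_bounds(3)[OF pr[OF i]] by (intro mult_right_mono of_nat_mono v[OF i]) simp
    then show "real (e i) * ln (real (p i)) \<le> real (multiplicity (p i) d) * ln (real (p i)) + (\<Sum>j\<in>{1..k} - {i}.
      real (fermat_val (p i) (p j) + multiplicity (p i) (e j + 1)) * ln (real (p i)))"
      by (simp only: of_nat_add of_nat_sum distrib_right sum_distrib_right)
  qed
  also have "(\<Sum>i=1..k. real (multiplicity (p i) d) * ln (real (p i)) + (\<Sum>j\<in>{1..k} - {i}.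
      real (fermat_val (p i) (p j) + multiplicity (p i) (e j + 1)) * ln (real (p i))))
      = (\<Sum>i=1..k. real (multiplicity (p i) d) * ln (real (p i))) + (\<Sum>i=1..k. \<Sum>j\<in>{1..k} - {i}.
      real (fermat_val (p i) (p j) + multiplicity (p i) (e j + 1)) * ln (real (p i)))"
    by (rule sum.distrib)
  also have "(\<Sum>i=1..k. real (multiplicity (p i) d) * ln (real (p i))) \<le> ln (real d)"
    by (rule sum_multiplicity_family_ln_le) (use pr N(3) inj in auto)
  finally show ?thesis by simp
qed

text \<open>After exchanging the sums, for fixed \<open>j\<close> the distinct primes
  \<open>p i\<close> together extract at most \<open>ln (e j + 1)\<close> from the single number
  \<open>e j + 1\<close>.\<close>

lemma sum_offdiag_multiplicity_le:
  fixes p e :: "nat \<Rightarrow> nat"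
  assumes pr: "\<And>i. i \<in> I \<Longrightarrow> prime (p i)" and inj: "inj_on p I" and I: "finite I"
  shows "(\<Sum>i\<in>I. \<Sum>j\<in>I - {i}. real (multiplicity (p i) (e j + 1)) * ln (real (p i)))
    \<le> (\<Sum>j\<in>I. ln (real (e j + 1)))"
proof -
  have "(\<Sum>i\<in>I. \<Sum>j\<in>I - {i}. real (multiplicity (p i) (e j + 1)) * ln (real (p i)))
      \<le> (\<Sum>i\<in>I. \<Sum>j\<in>I. real (multiplicity (p i) (e j + 1)) * ln (real (p i)))"
  proof (intro sum_mono sum_mono2)
    fix i j assume "i \<in> I"
    then show "0 \<le> real (multiplicity (p i) (e j + 1)) * ln (real (p i))"
      using ln_prime_bounds(3)[OF pr] by (simp add: less_imp_le)
  qed (use I in auto)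
  also have "\<dots> = (\<Sum>j\<in>I. \<Sum>i\<in>I. real (multiplicity (p i) (e j + 1)) * ln (real (p i)))"
    by (rule sum.swap)
  also have "\<dots> \<le> (\<Sum>j\<in>I. ln (real (e j + 1)))"
  proof (rule sum_mono)
    fix j
    show "(\<Sum>i\<in>I. real (multiplicity (p i) (e j + 1)) * ln (real (p i))) \<le> ln (real (e j + 1))"
      using I pr inj by (rule sum_multiplicity_family_ln_le) auto
  qed
  finally show ?thesis .
qed

section \<open>The unconditional bound\<close>

text \<open>Lets every \<open>p i\<close> be replaced by the largest or second largest prime. It
  follows from \<open>ln t \<le> t - 1\<close> at \<open>t = y / x\<close> and
  \<open>t = 1 / x\<close>.\<close>

lemma ratio_ln_mono:
  fixes x y :: real
  assumes "1 < x" and "x \<le> y"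
  shows "(x - 1) / ln x \<le> (y - 1) / ln y"
proof -
  have lx: "ln x > 0" "ln y > 0" using assms by auto
  have a: "ln y - ln x \<le> (y - x) / x"
    using ln_le_minus_one[of "y / x"] assms by (simp add: ln_div diff_divide_distrib)
  have b: "(x - 1) / x \<le> ln x"
    using ln_le_minus_one[of "1 / x"] assms by (simp add: ln_div diff_divide_distrib)
  have "(x - 1) * ln y = (x - 1) * ln x + (x - 1) * (ln y - ln x)"
    by (simp add: algebra_simps)
  also have "\<dots> \<le> (x - 1) * ln x + (x - 1) * ((y - x) / x)"
    using a assms by (intro add_left_mono mult_left_mono) auto
  also have "(x - 1) * ((y - x) / x) = (x - 1) / x * (y - x)" by simp
  also have "(x - 1) * ln x + (x - 1) / x * (y - x) \<le> (x - 1) * ln x + ln x * (y - x)"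
    using b assms by (intro add_left_mono mult_right_mono) auto
  also have "\<dots> = (y - 1) * ln x" by (simp add: algebra_simps)
  finally show ?thesis using lx by (simp add: field_simps)
qed

text \<open>Obtained from \<open>(e + 1)^2 \<le> 4 * 2 ^ e\<close>; the factor 1/2 lets the sum over
  all primes be absorbed into \<open>ln N\<close>.\<close>

lemma ln_Suc_le:
  assumes "prime p"
  shows "ln (real (e + 1)) \<le> real e * ln (real p) / 2 + 1"
proof -
  have "(e + 1)\<^sup>2 \<le> 4 * 2 ^ e"
  proof (induction e)
    case (Suc e)
    show ?case
    proof (cases "e \<ge> 2")
      case True
      then have "(Suc e + 1)\<^sup>2 \<le> 2 * (e + 1)\<^sup>2"
        using mult_le_mono[OF True True] by (simp add: power2_eq_square algebra_simps)
      then show ?thesis using Suc by simp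
    next
      case False
      then have "e = 0 \<or> e = 1" by auto
      then show ?thesis by (auto simp: power2_eq_square)
    qed
  qed simp
  also have "\<dots> \<le> 4 * p ^ e"
    using prime_ge_2_nat[OF assms] by (simp add: power_mono)
  finally have "real ((e + 1)\<^sup>2) \<le> real (4 * p ^ e)"
    by (rule of_nat_mono)
  then have "ln (real (e + 1) ^ 2) \<le> ln (4 * real p ^ e)"
    using prime_gt_0_nat[OF assms] by (subst ln_le_cancel_iff) auto
  moreover have "ln (4 :: real) \<le> 2"
    using ln_le_minus_one[of "2 :: real"] ln_realpow[of "2 :: real" 2] by simp
  ultimately show ?thesis
    using prime_gt_0_nat[OF assms] by (simp add: ln_mult ln_realpow)
qed

lemma abundancy_factorizationD:
  assumes "abundancy_factorization N n d k p e"
  shows "N > 0" "d > 0" "k \<ge> 1" "\<And>i. i \<in> {1..k} \<Longrightarrow> prime (p i)" "inj_on p {1..k}"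
    and "\<And>i j. i \<in> {1..k} \<Longrightarrow> j \<in> {1..k} \<Longrightarrow> i \<le> j \<Longrightarrow> p i \<le> p j"
    and "\<And>i. i \<in> {1..k} \<Longrightarrow> e i \<ge> 1"
    and "ln (real N) = (\<Sum>i=1..k. real (e i) * ln (real (p i)))"
proof -
  have *: "N > 0" "d > 0" "k \<ge> 1" "\<forall>i\<in>{1..k}. prime (p i) \<and> e i \<ge> 1"
    and sm: "strict_mono_on {1..k} p" and Np: "N = (\<Prod>i=1..k. p i ^ e i)"
    using assms unfolding abundancy_factorization_def by blast+
  show "N > 0" "d > 0" "k \<ge> 1" by (fact *)+
  show "prime (p i)" "e i \<ge> 1" if "i \<in> {1..k}" for i
    using * that by blast+
  then show "ln (real N) = (\<Sum>i=1..k. real (e i) * ln (real (p i)))"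
    unfolding Np by (intro ln_mult_prime_powers)
  show "inj_on p {1..k}" using sm by (rule strict_mono_on_imp_inj_on)
  show "p i \<le> p j" if "i \<in> {1..k}" "j \<in> {1..k}" "i \<le> j" for i j
    using strict_mono_on_leD[OF sm that] .
qed

text \<open>The logarithm of the product over the primes in the first bound, for
  \<open>C = 1\<close>. When \<open>k = 1\<close>, the factor \<open>real k - 1\<close> removes the
  unconstrained value \<open>p 0\<close>.\<close>

definition ratio_sum :: "nat \<Rightarrow> (nat \<Rightarrow> nat) \<Rightarrow> real" where
  "ratio_sum k p = (real k - 1) * ((real (p k) - 1) / ln (real (p k)) * (\<Sum>i=1..k-1. ln (real (p i)))
     + (real (p (k - 1)) - 1) / ln (real (p (k - 1))) * ln (real (p k)))"

text \<open>After exchanging the sums, \<open>ln (p j)\<close> multiplies the \<open>k - 1\<close>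
  ratios with \<open>i \<noteq> j\<close>. By monotonicity each is at most the ratio at
  \<open>p k\<close>, or at \<open>p (k - 1)\<close> when \<open>j = k\<close>; this is how
  \<open>p k\<close> gets paired with the second largest prime.\<close>

lemma sum_fermat_val_le:
  assumes "abundancy_factorization N n d k p e"
  shows "(\<Sum>i=1..k. \<Sum>j\<in>{1..k} - {i}. real (fermat_val (p i) (p j)) * ln (real (p i)))
    \<le> 640000000000 * ratio_sum k p"
proof -
  note D = abundancy_factorizationD[OF assms]
  define c :: real where "c = 640000000000"
  define f where "f = (\<lambda>i. (real (p i) - 1) / ln (real (p i)))"
  define l where "l = (\<lambda>i. ln (real (p i)))"
  have l: "l i > 0" if "i \<in> {1..k}" for i
    using ln_prime_bounds(3)[OF D(4)[OF that]] by (simp add: l_def)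
  have f: "f i \<le> f j" if "i \<in> {1..k}" "j \<in> {1..k}" "i \<le> j" for i j
    unfolding f_def using D(6)[OF that] prime_gt_1_nat[OF D(4)[OF that(1)]]
    by (intro ratio_ln_mono) auto
  have "(\<Sum>i=1..k. \<Sum>j\<in>{1..k} - {i}. real (fermat_val (p i) (p j)) * l i)
      \<le> (\<Sum>i=1..k. \<Sum>j\<in>{1..k} - {i}. c * (f i * l j))"
  proof (intro sum_mono)
    fix i j assume i: "i \<in> {1..k}" and j: "j \<in> {1..k} - {i}"
    have ne: "p i \<noteq> p j" using inj_onD[OF D(5), of i j] i j by blast
    have "real (fermat_val (p i) (p j)) * l i * l i \<le> c * (real (p i) - 1) * l j"
      using fermat_val_bound[OF D(4)[OF i] D(4) ne] j
      by (simp add: l_def c_def power2_eq_square mult.assoc)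
    then have "real (fermat_val (p i) (p j)) * l i \<le> c * (real (p i) - 1) * l j / l i"
      using l[OF i] by (simp add: le_divide_eq)
    then show "real (fermat_val (p i) (p j)) * l i \<le> c * (f i * l j)"
      by (simp add: f_def l_def)
  qed
  \<comment> \<open>Diagonal terms set to zero make the range rectangular, so that the sums can be
    exchanged.\<close>
  also have "\<dots> = (\<Sum>i=1..k. \<Sum>j\<in>{1..k}. if j = i then 0 else c * (f i * l j))"
    by (intro sum.cong refl sum.mono_neutral_cong_left) auto
  also have "\<dots> = (\<Sum>j=1..k. \<Sum>i\<in>{1..k}. if j = i then 0 else c * (f i * l j))"
    by (rule sum.swap)
  also have "\<dots> = (\<Sum>j=1..k. \<Sum>i\<in>{1..k} - {j}. c * (f i * l j))"
    by (intro sum.cong refl sum.mono_neutral_cong_right) auto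
  also have "\<dots> = c * (\<Sum>j=1..k. l j * (\<Sum>i\<in>{1..k} - {j}. f i))"
    by (simp add: sum_distrib_left mult_ac)
  also have "(\<Sum>j=1..k. l j * (\<Sum>i\<in>{1..k} - {j}. f i)) \<le> ratio_sum k p"
  proof -
    have k: "{1..k} = insert k {1..k-1}" "k \<notin> {1..k-1}"
      using D(3) by auto
    have bound: "(\<Sum>i\<in>{1..k} - {j}. f i) \<le> (real k - 1) * B"
      if j: "j \<in> {1..k}" and B: "\<And>i. i \<in> {1..k} - {j} \<Longrightarrow> f i \<le> B" for j B
    proof -
      have "(\<Sum>i\<in>{1..k} - {j}. f i) \<le> of_nat (card ({1..k} - {j})) * B"
        using B by (rule sum_bounded_above)
      then show ?thesis using j D(3) by (simp add: of_nat_diff)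
    qed
    have "(\<Sum>j=1..k. l j * (\<Sum>i\<in>{1..k} - {j}. f i))
        = l k * (\<Sum>i\<in>{1..k} - {k}. f i) + (\<Sum>j=1..k-1. l j * (\<Sum>i\<in>{1..k} - {j}. f i))"
      using k by (metis (no_types, lifting) finite_atLeastAtMost sum.insert)
    also have "\<dots> \<le> l k * ((real k - 1) * f (k - 1)) + (\<Sum>j=1..k-1. l j * ((real k - 1) * f k))"
    proof (intro add_mono sum_mono mult_left_mono bound)
      show "f i \<le> f (k - 1)" if "i \<in> {1..k} - {k}" for i
        using that by (intro f) auto
      show "f i \<le> f k" if "i \<in> {1..k} - {j}" for i j
        using that by (intro f) auto
    qed (use D(3) l in \<open>auto intro: less_imp_le\<close>)
    also have "\<dots> = ratio_sum k p"
      by (simp add: ratio_sum_def f_def l_def sum_distrib_left sum_distrib_right distrib_left mult_ac)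
    finally show ?thesis .
  qed
  finally show ?thesis by (simp add: c_def l_def)
qed

text \<open>Absorbs the additive \<open>k\<close> left by the bound for \<open>ln (e j + 1)\<close>.
  All ratios are at least 1 and \<open>ln (p 1) \<ge> 1 / 2\<close>, so \<open>ratio_sum\<close> is
  at least \<open>(k - 1) / 2\<close>.\<close>

lemma ratio_sum_ge:
  assumes "abundancy_factorization N n d k p e" and "k \<ge> 2"
  shows "real k \<le> 4 * ratio_sum k p"
proof -
  note D = abundancy_factorizationD[OF assms(1)]
  define f where "f = (\<lambda>i. (real (p i) - 1) / ln (real (p i)))"
  have f: "f i \<ge> 1" if "i \<in> {1..k}" for i
    using ln_prime_bounds[OF D(4)[OF that]] by (simp add: f_def)
  have pr: "prime (p 1)" "prime (p k)" using assms(2) by (auto intro: D(4))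
  have "1 / 2 \<le> ln (real (p 1))" by (rule ln_prime_bounds(1)[OF pr(1)])
  also have "\<dots> \<le> (\<Sum>i=1..k-1. ln (real (p i)))"
    using assms(2) D(4) ln_prime_bounds(3) by (intro member_le_sum) (auto simp: less_imp_le)
  finally have s: "1 / 2 \<le> (\<Sum>i=1..k-1. ln (real (p i)))" .
  have "1 * (1 / 2) \<le> f k * (\<Sum>i=1..k-1. ln (real (p i)))"
    using f[of k] s assms(2) by (intro mult_mono) auto
  moreover have "0 \<le> f (k - 1) * ln (real (p k))"
  proof (rule mult_nonneg_nonneg)
    have "k - 1 \<in> {1..k}" using assms(2) by auto
    from f[OF this] show "0 \<le> f (k - 1)" by simp
    show "0 \<le> ln (real (p k))" using ln_prime_bounds(3)[OF pr(2)] by simp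
  qed
  ultimately have "1 / 2 \<le> f k * (\<Sum>i=1..k-1. ln (real (p i))) + f (k - 1) * ln (real (p k))"
    by linarith
  then have "(real k - 1) * (1 / 2) \<le> ratio_sum k p"
    unfolding ratio_sum_def f_def using assms(2) by (intro mult_left_mono) simp_all
  then show ?thesis using assms(2) by simp
qed

lemma abundancy_ln_le_split:
  assumes "abundancy_factorization N n d k p e"
  shows "ln (real N) \<le> ln (real d)
    + (\<Sum>i=1..k. \<Sum>j\<in>{1..k} - {i}. real (fermat_val (p i) (p j)) * ln (real (p i)))
    + (\<Sum>j=1..k. ln (real (e j + 1)))"
proof -
  note D = abundancy_factorizationD[OF assms]
  show ?thesis
    using abundancy_ln_le[OF assms] sum_offdiag_multiplicity_le[OF D(4) D(5), of e]
    by (simp only: of_nat_add distrib_right sum.distrib finite_atLeastAtMost) simp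
qed

lemma abundancy_single_prime:
  assumes "abundancy_factorization N n d 1 p e"
  shows "ln (real N) \<le> ln (real d)"
  using abundancy_ln_le[OF assms] by simp

text \<open>The terms \<open>ln (e j + 1)\<close> cost \<open>ln N / 2 + k\<close>; moving the half
  to the left doubles the rest, and \<open>2 * (640000000000 + 4)\<close> is the constant. For
  \<open>k = 1\<close> the vanishing \<open>ratio_sum\<close> cannot absorb \<open>k\<close>, so
  that case is separate.\<close>

lemma abundancy_bound_unconditional:
  assumes "abundancy_factorization N n d k p e"
  shows "ln (real N) \<le> 1280000000008 * (ln (real d) + ratio_sum k p)"
proof (cases "k = 1")
  case True
  have "ln (real d) \<ge> 0"
    using abundancy_factorizationD(2)[OF assms] by simp
  moreover have "ratio_sum k p = 0" using True by (simp add: ratio_sum_def)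
  ultimately show ?thesis
    using abundancy_single_prime assms True by fastforce
next
  case False
  note D = abundancy_factorizationD[OF assms]
  have "k \<ge> 2" using False D(3) by simp
  have "(\<Sum>j=1..k. ln (real (e j + 1))) \<le> (\<Sum>j=1..k. real (e j) * ln (real (p j)) / 2 + 1)"
    by (intro sum_mono ln_Suc_le D(4))
  also have "\<dots> = ln (real N) / 2 + real k"
    unfolding D(8) by (simp add: sum.distrib sum_divide_distrib)
  finally have "ln (real N) \<le> ln (real d) + 640000000000 * ratio_sum k p + (ln (real N) / 2 + real k)"
    using abundancy_ln_le_split[OF assms] sum_fermat_val_le[OF assms] by linarith
  moreover have "ln (real d) \<ge> 0" using D(2) by simp
  ultimately show ?thesis
    using ratio_sum_ge[OF assms \<open>k \<ge> 2\<close>] by (simp add: algebra_simps)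
qed

section \<open>The conditional bound\<close>

text \<open>\<open>ln x \<le> x / exp 1\<close> at \<open>x = sqrt M\<close>. The constant is sharp
  and becomes the exponent \<open>exp 1 / (exp 1 - 2)\<close> of the conditional bound.\<close>

lemma ln_le_two_div_e_sqrt:
  fixes M :: real
  assumes "M > 0"
  shows "ln M \<le> 2 / exp 1 * sqrt M"
proof -
  have "ln (sqrt M / exp 1) \<le> sqrt M / exp 1 - 1"
    using assms by (intro ln_le_minus_one) simp
  then have "ln (sqrt M) \<le> sqrt M / exp 1"
    using assms by (simp add: ln_div)
  then show ?thesis using assms by (simp add: ln_sqrt mult.commute)
qed

text \<open>Concavity through the tangent line of \<open>ln\<close> at the mean. The division by
  \<open>card I\<close> later produces the term \<open>- k * ln k\<close>.\<close>

lemma sum_ln_le_AM_GM: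
  fixes x :: "'i \<Rightarrow> real"
  assumes "finite I" and "I \<noteq> {}" and "\<And>i. i \<in> I \<Longrightarrow> x i > 0"
  shows "(\<Sum>i\<in>I. ln (x i)) \<le> real (card I) * ln ((\<Sum>i\<in>I. x i) / real (card I))"
proof -
  define a where "a = (\<Sum>i\<in>I. x i) / real (card I)"
  have c: "real (card I) > 0" using assms by (simp add: card_gt_0_iff)
  have a: "a > 0" unfolding a_def using c assms by (intro divide_pos_pos sum_pos) auto
  have "(\<Sum>i\<in>I. ln (x i)) \<le> (\<Sum>i\<in>I. ln a + (x i / a - 1))"
  proof (rule sum_mono)
    fix i assume "i \<in> I"
    then have "ln (x i / a) \<le> x i / a - 1" "x i > 0"
      using assms a by (auto intro!: ln_le_minus_one)
    then show "ln (x i) \<le> ln a + (x i / a - 1)" using a by (simp add: ln_div)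
  qed
  also have "\<dots> = real (card I) * ln a + ((\<Sum>i\<in>I. x i) / a - real (card I))"
    by (simp add: sum.distrib sum_subtractf sum_divide_distrib)
  also have "(\<Sum>i\<in>I. x i) / a = real (card I)"
  proof -
    have "a * real (card I) = (\<Sum>i\<in>I. x i)" using c by (simp add: a_def)
    then show ?thesis using a by (simp add: divide_eq_eq mult.commute)
  qed
  finally show ?thesis by (simp add: a_def)
qed

lemma fermat_val_hypothesis_bound:
  assumes "fermat_valuation_hypothesis"
  obtains B :: real where "B \<ge> 0"
    and "\<And>p q. prime p \<Longrightarrow> prime q \<Longrightarrow>
           real (fermat_val p q) * ln (real p) \<le> B * ln (real p) + 2 * ln (real q)"
proof -
  define v where "v = (\<lambda>q p. multiplicity (int p) (int q ^ (p - 1) - 1))"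
  define X where "X = {(q :: nat, p :: nat). prime q \<and> prime p \<and>
       \<not> real (v q p) \<le> 2 + (ln (real q) + ln (ln (real q)) + ln (ln (real p))) / ln (real p)}"
  have fin: "finite X"
    using assms by (simp add: fermat_valuation_hypothesis_def X_def v_def)
  \<comment> \<open>The sum dominates the finitely many exceptional valuations; the 3 covers
    \<open>2 * ln p\<close> and \<open>ln (ln p) \<le> ln p\<close>.\<close>
  define B where "B = 3 + (\<Sum>(q, p)\<in>X. real (v q p))"
  have B3: "B \<ge> 3" unfolding B_def by (simp add: sum_nonneg case_prod_unfold)
  show thesis
  proof (rule that[of B])
    show "B \<ge> 0" using B3 by simp
    fix p q :: nat assume p: "prime p" and q: "prime q"
    note lp = ln_prime_bounds[OF p] and lq = ln_prime_bounds[OF q]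
    show "real (fermat_val p q) * ln (real p) \<le> B * ln (real p) + 2 * ln (real q)"
    proof (cases "p = 2")
      case True
      \<comment> \<open>For \<open>p = 2\<close> the exponent in \<open>fermat_val\<close> is 2, not
        the one in the hypothesis; the trivial bound is already \<open>2 * ln q\<close>.\<close>
      have "0 \<le> B * ln (real p)" using B3 lp by simp
      then show ?thesis using fermat_val_ln_le[OF p q] True by simp
    next
      case False
      have "int q ^ (p - 1) - 1 = int (q ^ (p - 1) - 1)"
        using prime_gt_0_nat[OF q] by (simp add: of_nat_diff)
      then have fv: "fermat_val p q = v q p"
        using False by (simp only: v_def multiplicity_int fermat_val_def if_False)
      show ?thesis
      proof (cases "(q, p) \<in> X")
        case True
        have "real (v q p) \<le> (\<Sum>(q, p)\<in>X. real (v q p))"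
          using member_le_sum[OF True, of "\<lambda>(q, p). real (v q p)"] fin by auto
        then have "real (v q p) * ln (real p) \<le> B * ln (real p)"
          using lp by (intro mult_right_mono) (auto simp: B_def)
        then show ?thesis using lq fv by simp
      next
        case False
        have cancel: "(2 + x / ln (real p)) * ln (real p) = 2 * ln (real p) + x" for x
          using lp(3) by (simp add: distrib_right)
        from False have "real (v q p) \<le> 2 + (ln (real q) + ln (ln (real q)) + ln (ln (real p))) / ln (real p)"
          using p q by (auto simp: X_def)
        then have "real (v q p) * ln (real p)
            \<le> (2 + (ln (real q) + ln (ln (real q)) + ln (ln (real p))) / ln (real p)) * ln (real p)"
          using lp by (intro mult_right_mono) auto
        also have "\<dots> = 2 * ln (real p) + (ln (real q) + ln (ln (real q)) + ln (ln (real p)))"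
          by (rule cancel)
        also have "\<dots> \<le> 3 * ln (real p) + 2 * ln (real q)"
          using ln_le_minus_one[OF lp(3)] ln_le_minus_one[OF lq(3)] by simp
        also have "\<dots> \<le> B * ln (real p) + 2 * ln (real q)"
          using B3 lp by (intro add_right_mono mult_right_mono) auto
        finally show ?thesis using fv by simp
      qed
    qed
  qed
qed

text \<open>\<open>large\<close> says \<open>k \<le> sqrt (ln N)\<close>, so
  \<open>k * ln (ln N)\<close> is at most \<open>2 / exp 1 * ln N\<close> and can be moved to the
  left. The inequality of means for the numbers \<open>e j + 1\<close> supplies this term together
  with \<open>- k * ln k\<close>.\<close>

lemma abundancy_bound_conditional:
  assumes ab: "abundancy_factorization N n d k p e" and "B \<ge> 0"
    and B: "\<And>p q. prime p \<Longrightarrow> prime q \<Longrightarrow>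
           real (fermat_val p q) * ln (real p) \<le> B * ln (real p) + 2 * ln (real q)"
    and large: "(real k)\<^sup>2 \<le> ln (real N)"
  shows "(1 - 2 / exp 1) * ln (real N)
    \<le> ln (real d) - real k * ln (real k) + (B + 6) * (real k * (\<Sum>i=1..k. ln (real (p i))))"
proof -
  note D = abundancy_factorizationD[OF ab]
  define M where "M = ln (real N)"
  define l where "l = (\<lambda>i. ln (real (p i)))"
  define P where "P = (\<Sum>i=1..k. l i)"
  have l: "l i \<ge> 1 / 2" if "i \<in> {1..k}" for i
    using ln_prime_bounds(1)[OF D(4)[OF that]] by (simp add: l_def)
  then have l0: "l i \<ge> 0" if "i \<in> {1..k}" for i
    using that by (meson order_trans zero_le_divide_1_iff zero_le_numeral)
  have "real k * (1 / 2) \<le> P"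
    using sum_bounded_below[of "{1..k}" "1 / 2" l] l by (simp add: P_def)
  then have kP: "real k \<le> 2 * P" by simp
  have k1: "real k \<ge> 1" using D(3) by simp
  have M1: "M \<ge> 1" "M > 0" "real k \<le> sqrt M"
  proof -
    show "M \<ge> 1" using large one_le_power[OF k1, of 2] unfolding M_def by linarith
    then show "M > 0" by simp
    show "real k \<le> sqrt M" using large by (auto simp: M_def intro: real_le_rsqrt)
  qed
  have "(\<Sum>i=1..k. \<Sum>j\<in>{1..k} - {i}. real (fermat_val (p i) (p j)) * l i)
      \<le> (\<Sum>i=1..k. \<Sum>j=1..k. B * l i + 2 * l j)"
  proof (intro sum_mono order_trans[OF sum_mono sum_mono2])
    fix i j assume "i \<in> {1..k}" "j \<in> {1..k} - {i}"
    then show "real (fermat_val (p i) (p j)) * l i \<le> B * l i + 2 * l j"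
      using B[OF D(4) D(4), of i j] by (simp add: l_def)
  next
    fix i j assume "i \<in> {1..k}" "j \<in> {1..k} - ({1..k} - {i})"
    then show "0 \<le> B * l i + 2 * l j" using l0[of i] \<open>B \<ge> 0\<close> by auto
  qed auto
  also have "\<dots> = (B + 2) * (real k * P)"
    by (simp add: sum.distrib P_def sum_distrib_left algebra_simps)
  finally have fv: "(\<Sum>i=1..k. \<Sum>j\<in>{1..k} - {i}. real (fermat_val (p i) (p j)) * l i)
      \<le> (B + 2) * (real k * P)" .
  \<comment> \<open>The factor 4 combines \<open>e j + 1 \<le> 2 * e j\<close> with
    \<open>ln (p j) \<ge> 1 / 2\<close>.\<close>
  have esum: "(\<Sum>j=1..k. real (e j + 1)) \<le> 4 * M"
  proof -
    have "(\<Sum>j=1..k. real (e j + 1)) \<le> (\<Sum>j=1..k. 4 * (real (e j) * l j))"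
    proof (rule sum_mono)
      fix j assume j: "j \<in> {1..k}"
      have "real (e j + 1) \<le> 2 * real (e j)" using D(7)[OF j] by simp
      also have "\<dots> \<le> 4 * (real (e j) * l j)"
        using mult_left_mono[OF l[OF j], of "real (e j)"] by (simp add: mult_ac)
      finally show "real (e j + 1) \<le> 4 * (real (e j) * l j)" .
    qed
    then show ?thesis by (simp add: M_def D(8) l_def sum_distrib_left)
  qed
  have "(\<Sum>j=1..k. ln (real (e j + 1))) \<le> real k * ln ((\<Sum>j=1..k. real (e j + 1)) / real k)"
    using sum_ln_le_AM_GM[of "{1..k}" "\<lambda>j. real (e j + 1)"] D(3) by simp
  also have "\<dots> \<le> real k * ln (4 * M / real k)"
  proof (intro mult_left_mono iffD2[OF ln_le_cancel_iff] divide_right_mono esum)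
    show "0 < (\<Sum>j=1..k. real (e j + 1)) / real k"
      using D(3) by (intro divide_pos_pos sum_pos) auto
  qed (use k1 M1 in auto)
  also have "\<dots> = real k * ln 4 + real k * ln M - real k * ln (real k)"
    using k1 M1 by (simp add: ln_div ln_mult algebra_simps)
  also have "real k * ln 4 \<le> 4 * (real k * P)"
  proof -
    have "ln (4 :: real) \<le> 2"
      using ln_le_minus_one[of "2 :: real"] ln_realpow[of "2 :: real" 2] by simp
    moreover have "2 \<le> 4 * P" using kP k1 by simp
    ultimately have "real k * ln 4 \<le> real k * (4 * P)"
      using k1 by (intro mult_left_mono) auto
    then show ?thesis by simp
  qed
  also have "real k * ln M \<le> 2 / exp 1 * M"
  proof -
    have "real k * ln M \<le> sqrt M * (2 / exp 1 * sqrt M)"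
      using M1 ln_le_two_div_e_sqrt[of M] by (intro mult_mono) auto
    also have "\<dots> = 2 / exp 1 * M" using M1 by simp
    finally show ?thesis .
  qed
  finally have es: "(\<Sum>j=1..k. ln (real (e j + 1))) \<le> 4 * (real k * P) + 2 / exp 1 * M - real k * ln (real k)"
    by simp
  \<comment> \<open>In the coefficient \<open>B + 6\<close>, the part \<open>B + 2\<close> comes
    from the Fermat valuations and 4 from \<open>k * ln 4\<close>.\<close>
  have "M \<le> ln (real d) + (B + 2) * (real k * P)
      + (4 * (real k * P) + 2 / exp 1 * M - real k * ln (real k))"
    using abundancy_ln_le_split[OF ab] fv es unfolding M_def l_def by linarith
  then show ?thesis
    by (simp add: M_def P_def l_def algebra_simps)
qed

theorem theorem4:
  shows "(\<exists>C :: real. \<forall>N n d k p e. abundancy_factorization N n d k p e \<longrightarrow>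
            real N \<le> real d powr C
              * (\<Prod>i=1..k-1. real (p i) powr (C * (real k - 1) * (real (p k) - 1) / ln (real (p k))))
              * real (p k) powr (C * (real k - 1) * (real (p (k - 1)) - 1) / ln (real (p (k - 1)))))
       \<and> (fermat_valuation_hypothesis \<longrightarrow>
          (\<exists>C' :: real. \<forall>N n d k p e. abundancy_factorization N n d k p e \<longrightarrow>
            real N < max (exp ((real k)\<^sup>2))
              (real d powr (exp 1 / (exp 1 - 2))
                * real k powr (- (real k * exp 1 / (exp 1 - 2)))
                * (\<Prod>i=1..k. real (p i)) powr (real k * C'))))"
proof (intro conjI impI)
  define C :: real where "C = 1280000000008"
  show "\<exists>C :: real. \<forall>N n d k p e. abundancy_factorization N n d k p e \<longrightarrow>
            real N \<le> real d powr C
              * (\<Prod>i=1..k-1. real (p i) powr (C * (real k - 1) * (real (p k) - 1) / ln (real (p k))))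
              * real (p k) powr (C * (real k - 1) * (real (p (k - 1)) - 1) / ln (real (p (k - 1))))"
  proof (intro exI[of _ C] allI impI)
    fix N n d k p e assume ab: "abundancy_factorization N n d k p e"
    note D = abundancy_factorizationD[OF ab]
    have pos: "real (p i) > 0" if "i \<in> {1..k}" for i
      using prime_gt_0_nat[OF D(4)[OF that]] by simp
    let ?a = "C * (real k - 1) * (real (p k) - 1) / ln (real (p k))"
    let ?b = "C * (real k - 1) * (real (p (k - 1)) - 1) / ln (real (p (k - 1)))"
    have 1: "real d powr C = exp (C * ln (real d))"
      using D(2) by (simp add: powr_def)
    have "(\<Prod>i=1..k-1. real (p i) powr ?a) = (\<Prod>i=1..k-1. exp (?a * ln (real (p i))))"
    proof (rule prod.cong)
      show "real (p i) powr ?a = exp (?a * ln (real (p i)))" if "i \<in> {1..k-1}" for i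
      proof -
        have "i \<in> {1..k}" using that by auto
        from pos[OF this] show ?thesis by (simp add: powr_def)
      qed
    qed simp
    also have "\<dots> = exp (?a * (\<Sum>i=1..k-1. ln (real (p i))))"
      by (simp only: exp_sum[OF finite_atLeastAtMost] sum_distrib_left)
    finally have 2: "(\<Prod>i=1..k-1. real (p i) powr ?a) = exp (?a * (\<Sum>i=1..k-1. ln (real (p i))))" .
    have 3: "real (p k) powr ?b = exp (?b * ln (real (p k)))"
      using pos[of k] D(3) by (simp add: powr_def)
    have "real N = exp (ln (real N))" using D(1) by simp
    also have "\<dots> \<le> exp (C * (ln (real d) + ratio_sum k p))"
      using abundancy_bound_unconditional[OF ab] by (simp add: C_def)
    also have "C * (ln (real d) + ratio_sum k p)
        = C * ln (real d) + ?a * (\<Sum>i=1..k-1. ln (real (p i))) + ?b * ln (real (p k))"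
      unfolding ratio_sum_def by (simp add: algebra_simps)
    finally show "real N \<le> real d powr C * (\<Prod>i=1..k-1. real (p i) powr ?a) * real (p k) powr ?b"
      unfolding 1 2 3 by (simp only: exp_add)
  qed
next
  assume fermat_valuation_hypothesis
  then obtain B :: real where B: "B \<ge> 0" "\<And>p q. prime p \<Longrightarrow> prime q \<Longrightarrow>
           real (fermat_val p q) * ln (real p) \<le> B * ln (real p) + 2 * ln (real q)"
    by (rule fermat_val_hypothesis_bound) blast
  \<comment> \<open>The inverse of the factor \<open>1 - 2 / exp 1\<close> left at
    \<open>ln N\<close>.\<close>
  define \<theta> :: real where "\<theta> = exp 1 / (exp 1 - 2)"
  have e2: "exp 1 > (2 :: real)"
    using exp_less_mono[OF ln_2_less_1] by simp
  then have \<theta>: "\<theta> > 0" "\<theta> * (1 - 2 / exp 1) = 1"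
    by (simp_all add: \<theta>_def field_simps)
  \<comment> \<open>The extra 1 makes the final inequality strict, as
    \<open>k * P > 0\<close>.\<close>
  define C' where "C' = \<theta> * (B + 6) + 1"
  show "\<exists>C' :: real. \<forall>N n d k p e. abundancy_factorization N n d k p e \<longrightarrow>
            real N < max (exp ((real k)\<^sup>2))
              (real d powr (exp 1 / (exp 1 - 2))
                * real k powr (- (real k * exp 1 / (exp 1 - 2)))
                * (\<Prod>i=1..k. real (p i)) powr (real k * C'))"
  proof (intro exI[of _ C'] allI impI)
    fix N n d k p e assume ab: "abundancy_factorization N n d k p e"
    note D = abundancy_factorizationD[OF ab]
    define P where "P = (\<Sum>i=1..k. ln (real (p i)))"
    have pos: "real (p i) > 0" if "i \<in> {1..k}" for i
      using prime_gt_0_nat[OF D(4)[OF that]] by simp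
    have "P > 0"
      unfolding P_def using D(3) ln_prime_bounds(3)[OF D(4)] by (intro sum_pos) auto
    then have kP: "real k * P > 0" using D(3) by simp
    have lnprod: "ln (\<Prod>i=1..k. real (p i)) = P"
      unfolding P_def using pos by (intro ln_prod) auto
    have prodpos: "(\<Prod>i=1..k. real (p i)) > 0"
      using pos by (intro prod_pos) auto
    let ?R = "real d powr (exp 1 / (exp 1 - 2)) * real k powr (- (real k * exp 1 / (exp 1 - 2)))
                * (\<Prod>i=1..k. real (p i)) powr (real k * C')"
    have R: "?R = exp (\<theta> * ln (real d) - \<theta> * (real k * ln (real k)) + C' * (real k * P))"
    proof -
      have "real k * exp 1 / (exp 1 - 2) = \<theta> * real k" by (simp add: \<theta>_def)
      moreover have "(\<Prod>i=1..k. real (p i)) powr (real k * C') = exp (real k * C' * P)"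
        using prodpos lnprod by (metis less_irrefl powr_def)
      ultimately have "?R = exp (\<theta> * ln (real d)) * exp (- (\<theta> * real k) * ln (real k)) * exp (real k * C' * P)"
        using D(2,3) by (simp add: powr_def[of "real _"] \<theta>_def)
      also have "\<dots> = exp (\<theta> * ln (real d) + - (\<theta> * real k) * ln (real k) + real k * C' * P)"
        by (simp only: exp_add)
      finally show ?thesis by (simp add: algebra_simps)
    qed
    show "real N < max (exp ((real k)\<^sup>2)) ?R"
    proof (cases "ln (real N) < (real k)\<^sup>2")
      case True
      then have "exp (ln (real N)) < exp ((real k)\<^sup>2)" by (simp only: exp_less_cancel_iff)
      then show ?thesis using D(1) by simp
    next
      case False
      then have "(1 - 2 / exp 1) * ln (real N)
          \<le> ln (real d) - real k * ln (real k) + (B + 6) * (real k * P)"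
        unfolding P_def by (intro abundancy_bound_conditional[OF ab B]) auto
      then have "\<theta> * ((1 - 2 / exp 1) * ln (real N))
          \<le> \<theta> * (ln (real d) - real k * ln (real k) + (B + 6) * (real k * P))"
        using \<theta>(1) by (intro mult_left_mono) auto
      then have "ln (real N)
          \<le> \<theta> * ln (real d) - \<theta> * (real k * ln (real k)) + \<theta> * (B + 6) * (real k * P)"
        unfolding mult.assoc[symmetric] \<theta>(2) by (simp add: algebra_simps)
      also have "\<dots> < \<theta> * ln (real d) - \<theta> * (real k * ln (real k)) + C' * (real k * P)"
        using kP by (simp add: C'_def algebra_simps)
      finally have "exp (ln (real N)) < ?R"
        unfolding R by (simp only: exp_less_cancel_iff)
      then show ?thesis using D(1) by simp
    qed
  qed
qed

end
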